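(* Let $n\ge 1$. (1) The set $[\mathsf{L}^n,\mathsf{R}]$ of homotopy classes of continuous maps $\mathsf{L}^n\to\mathsf{R}$ is in bijection with the set of antichains of $\mathcal{P}^a(N^\pm)\setminus\{\emptyset\}$. (2) $[\mathsf{R}^n,\mathsf{L}]$ is the union of $[\mathsf{R}^n,\mathsf{L}^+]$ and $[\mathsf{R}^n,\mathsf{L}^-]$ where bounded maps in $\mathsf{L}^+$ and $\mathsf{L}^-$ are identified; that is, the map from the disjoint union $[\mathsf{R}^n,\mathsf{L}^+]\sqcup[\mathsf{R}^n,\mathsf{L}^-]$ to $[\mathsf{R}^n,\mathsf{L}]$ induced by the inclusions $\mathsf{L}^\pm\subset\mathsf{L}$ becomes a bijection after identifying the class of bounded maps in $[\mathsf{R}^n,\mathsf{L}^+]$ with the class of bounded maps in $[\mathsf{R}^n,\mathsf{L}^-]$.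
   Context: $\mathsf{R}$ denotes Alexandroff's closed long ray: the set $\omega_1\times[0,1[$ with the lexicographic order and the order topology; its least element is denoted $0$. The long line $\mathsf{L}$ is the union of two copies $\mathsf{L}^+,\mathsf{L}^-$ of $\mathsf{R}$ glued at $0$. Powers carry the product topology, and $[X,Y]$ is the set of free homotopy classes of continuous maps $X\to Y$. A map into $\mathsf{R}$ (or $\mathsf{L}^\pm\cong\mathsf{R}$) is bounded if its image is contained in $[0,z]$ for some $z$ (all bounded maps $\mathsf{R}^n\to\mathsf{L}^\pm$ form a single homotopy class). $N=\{1,\dots,n\}$ and $N^\pm=\{+1,\dots,+n,-1,\dots,-n\}$ is the set of signed coordinates. A subset $I\subset N^\pm$ is admissible if for every $i\in N$, $I$ does not contain both $+i$ and $-i$. $\mathcal{P}^a(N^\pm)$ is the set of admissible subsets of $N^\pm$, ordered by inclusion. An antichain is a set of pairwise incomparable elements; the empty antichain is included. *)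

theory Defs
  imports "HOL-Analysis.Analysis" "HOL-Library.Countable_Set_Type"
begin

section \<open>The long ray and the long line\<close>

text \<open>The first uncountable ordinal is the well-ordered set of the cardinal successor of
  \<^term>\<open>natLeq\<close>; the instance \<open>wellorder\<close> together with
  \<open>uncountable_omega1\<close> and \<open>countable_lessThan_omega1\<close> below characterises it up to order isomorphism.\<close>

lemma Card_order_cardSuc_natLeq: "Card_order (cardSuc natLeq)"
  by (rule cardSuc_Card_order[OF natLeq_Card_order])

lemma Well_order_cardSuc_natLeq: "Well_order (cardSuc natLeq)"
  using Card_order_cardSuc_natLeq unfolding card_order_on_def by blast

typedef omega1 = "Field (cardSuc natLeq)"
  using Field_cardSuc_not_empty[OF natLeq_Card_order] by blast

instantiation omega1 :: wellorder
begin

definition less_eq_omega1 :: "omega1 \<Rightarrow> omega1 \<Rightarrow> bool" where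
  "x \<le> y \<longleftrightarrow> (Rep_omega1 x, Rep_omega1 y) \<in> cardSuc natLeq"

definition less_omega1 :: "omega1 \<Rightarrow> omega1 \<Rightarrow> bool" where
  "(x :: omega1) < y \<longleftrightarrow> x \<le> y \<and> x \<noteq> y"

instance
proof
  have anti: "antisym (cardSuc natLeq)" and tr: "trans (cardSuc natLeq)"
    and re: "refl_on (Field (cardSuc natLeq)) (cardSuc natLeq)"
    and tot: "total_on (Field (cardSuc natLeq)) (cardSuc natLeq)"
    and wf: "wf (cardSuc natLeq - Id)"
    using Well_order_cardSuc_natLeq
    unfolding well_order_on_def linear_order_on_def partial_order_on_def preorder_on_def
    by blast+
  have inj: "Rep_omega1 x = Rep_omega1 y \<longleftrightarrow> x = y" for x y
    by (rule Rep_omega1_inject)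
  fix x y z :: omega1
  show refl: "x \<le> x" for x :: omega1
    using re Rep_omega1[of x] unfolding less_eq_omega1_def refl_on_def by blast
  show *: "x \<le> y \<Longrightarrow> y \<le> x \<Longrightarrow> x = y" for x y :: omega1
    unfolding less_eq_omega1_def using antisymD[OF anti] inj[of x y] by blast
  show "(x < y) = (x \<le> y \<and> \<not> y \<le> x)"
    unfolding less_omega1_def using *[of x y] refl[of x] by blast
  show "x \<le> y \<Longrightarrow> y \<le> z \<Longrightarrow> x \<le> z"
    unfolding less_eq_omega1_def by (rule transD[OF tr])
  show "x \<le> y \<or> y \<le> x"
  proof (cases "x = y")
    case False
    then have "Rep_omega1 x \<noteq> Rep_omega1 y" using inj by blast
    then show ?thesis
      using tot Rep_omega1[of x] Rep_omega1[of y]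
      unfolding less_eq_omega1_def total_on_def by blast
  next
    case True
    then show ?thesis using refl[of x] by simp
  qed
  fix P :: "omega1 \<Rightarrow> bool" and a
  assume step: "\<And>x. (\<And>y. y < x \<Longrightarrow> P y) \<Longrightarrow> P x"
  have "wf (inv_image (cardSuc natLeq - Id) Rep_omega1)"
    by (rule wf_inv_image[OF wf])
  then show "P a"
  proof (induction a rule: wf_induct_rule)
    case (less x)
    show ?case
    proof (rule step)
      fix y assume "y < x"
      then have "(y, x) \<in> inv_image (cardSuc natLeq - Id) Rep_omega1"
        by (simp add: inv_image_def less_omega1_def less_eq_omega1_def inj)
      then show "P y" by (rule less.IH)
    qed
  qed
qed

end

lemma uncountable_omega1:
  includes cardinal_syntax
  shows "uncountable (UNIV :: omega1 set)"
proof
  assume "countable (UNIV :: omega1 set)"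
  then have "countable (range Rep_omega1)" by simp
  then have "countable (Field (cardSuc natLeq))"
    by (simp add: type_definition.Rep_range[OF type_definition_omega1])
  then have "|Field (cardSuc natLeq)| \<le>o natLeq"
    by (simp add: countable_card_le_natLeq)
  then have "cardSuc natLeq \<le>o natLeq"
    using card_of_Field_ordIso[OF Card_order_cardSuc_natLeq]
    by (metis ordIso_ordLeq_trans ordIso_symmetric)
  then show False
    using cardSuc_greater[OF natLeq_Card_order] not_ordLess_ordLeq by blast
qed

lemma countable_lessThan_omega1:
  includes cardinal_syntax
  shows "countable {..< a :: omega1}"
proof -
  let ?r = "cardSuc natLeq"
  have "|underS ?r (Rep_omega1 a)| <o ?r"
    by (rule card_of_underS[OF Card_order_cardSuc_natLeq Rep_omega1])
  then have "|underS ?r (Rep_omega1 a)| \<le>o natLeq"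
    by (simp add: cardSuc_ordLeq_ordLess[OF natLeq_Card_order card_of_Card_order])
  then have "countable (underS ?r (Rep_omega1 a))"
    by (simp add: countable_card_le_natLeq)
  moreover have "Rep_omega1 ` {..< a} \<subseteq> underS ?r (Rep_omega1 a)"
    by (auto simp: underS_def less_omega1_def less_eq_omega1_def Rep_omega1_inject)
  ultimately have "countable (Rep_omega1 ` {..< a})"
    by (rule countable_subset[rotated])
  then show ?thesis
    by (rule countable_image_inj_on) (auto simp: inj_on_def Rep_omega1_inject)
qed

typedef long_ray = "(UNIV :: omega1 set) \<times> {0 ..< 1 :: real}"
  by (rule exI[of _ "(undefined, 0)"]) simp

instantiation long_ray :: linorder
begin

definition less_long_ray :: "long_ray \<Rightarrow> long_ray \<Rightarrow> bool" where
  "x < y \<longleftrightarrow> fst (Rep_long_ray x) < fst (Rep_long_ray y) \<or>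
     fst (Rep_long_ray x) = fst (Rep_long_ray y) \<and> snd (Rep_long_ray x) < snd (Rep_long_ray y)"

definition less_eq_long_ray :: "long_ray \<Rightarrow> long_ray \<Rightarrow> bool" where
  "(x :: long_ray) \<le> y \<longleftrightarrow> x < y \<or> x = y"

instance
proof
  fix x y z :: long_ray
  show "(x < y) = (x \<le> y \<and> \<not> y \<le> x)"
    by (auto simp: less_eq_long_ray_def less_long_ray_def)
  show "x \<le> x"
    by (simp add: less_eq_long_ray_def)
  show "x \<le> y \<Longrightarrow> y \<le> z \<Longrightarrow> x \<le> z"
    by (auto simp: less_eq_long_ray_def less_long_ray_def)
  show "x \<le> y \<Longrightarrow> y \<le> x \<Longrightarrow> x = y"
    by (auto simp: less_eq_long_ray_def less_long_ray_def)
  show "x \<le> y \<or> y \<le> x"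
    by (auto simp: less_eq_long_ray_def less_long_ray_def Rep_long_ray_inject[symmetric] prod_eq_iff)
qed

end

instantiation long_ray :: linorder_topology
begin

definition open_long_ray :: "long_ray set \<Rightarrow> bool" where
  "open_long_ray = generate_topology (range (\<lambda>a. {..< a}) \<union> range (\<lambda>a. {a <..}))"

instance
  by standard (rule open_long_ray_def)

end

instantiation long_ray :: zero
begin

definition zero_long_ray :: long_ray where
  "0 = Abs_long_ray (LEAST a. True, 0)"

instance ..

end

lemma long_ray_zero_le: "(0 :: long_ray) \<le> x"
proof -
  have "Rep_long_ray 0 = (LEAST a. True, 0)"
    by (simp add: zero_long_ray_def Abs_long_ray_inverse)
  moreover have "(LEAST a. True) \<le> fst (Rep_long_ray x)"
    by (rule Least_le) simp
  moreover have "0 \<le> snd (Rep_long_ray x)"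
    using Rep_long_ray[of x] by (auto simp: mem_Times_iff)
  ultimately show ?thesis
    by (auto simp: less_eq_long_ray_def less_long_ray_def Rep_long_ray_inject[symmetric] prod_eq_iff)
qed

text \<open>The long line is the quotient space of two disjoint copies of the long ray,
  \<^term>\<open>Inl\<close> giving the positive and \<^term>\<open>Inr\<close> the negative one.\<close>

quotient_type long_line = "long_ray + long_ray" /
  "\<lambda>x y. x = y \<or> (x \<in> {Inl 0, Inr 0} \<and> y \<in> {Inl 0, Inr 0})"
  by (rule equivpI) (auto simp: reflp_def symp_def transp_def)

definition pos_ray :: "long_ray \<Rightarrow> long_line" where
  "pos_ray x = abs_long_line (Inl x)"

definition neg_ray :: "long_ray \<Rightarrow> long_line" where
  "neg_ray x = abs_long_line (Inr x)"

instantiation long_line :: topological_space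
begin

definition open_long_line :: "long_line set \<Rightarrow> bool" where
  "open (U :: long_line set) \<longleftrightarrow> open (pos_ray -` U) \<and> open (neg_ray -` U)"

instance
proof
  show "open (UNIV :: long_line set)"
    by (simp add: open_long_line_def)
  show "open (S \<inter> T)" if "open S" "open T" for S T :: "long_line set"
    using that by (auto simp: open_long_line_def vimage_Int)
  show "open (\<Union>K)" if "\<forall>S\<in>K. open S" for K :: "long_line set set"
    using that by (auto simp: open_long_line_def vimage_Union)
qed

end

text \<open>The subspaces \<open>L\<^sup>+\<close> and \<open>L\<^sup>-\<close> of the long line.\<close>

definition L_pos :: "long_line topology" where
  "L_pos = subtopology euclidean (range pos_ray)"

definition L_neg :: "long_line topology" where
  "L_neg = subtopology euclidean (range neg_ray)"

definition power_top :: "nat \<Rightarrow> 'a topology \<Rightarrow> (nat \<Rightarrow> 'a) topology" where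
  "power_top n X = product_topology (\<lambda>_. X) {1..n}"

abbreviation long_ray_power :: "nat \<Rightarrow> (nat \<Rightarrow> long_ray) topology" where
  "long_ray_power n \<equiv> power_top n euclidean"

abbreviation long_line_power :: "nat \<Rightarrow> (nat \<Rightarrow> long_line) topology" where
  "long_line_power n \<equiv> power_top n euclidean"

section \<open>Homotopy classes\<close>

text \<open>Maps are HOL functions whose values outside the carrier of the source are arbitrary.
  Two maps that agree on the carrier are homotopic, so the classes are not affected.\<close>

definition homotopy_rel :: "'a topology \<Rightarrow> 'b topology \<Rightarrow> (('a \<Rightarrow> 'b) \<times> ('a \<Rightarrow> 'b)) set" where
  "homotopy_rel X Y = {(f, g). homotopic_with (\<lambda>_. True) X Y f g}"

definition homotopy_classes :: "'a topology \<Rightarrow> 'b topology \<Rightarrow> ('a \<Rightarrow> 'b) set set" where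
  "homotopy_classes X Y = {f. continuous_map X Y f} // homotopy_rel X Y"

lemma equiv_homotopy_rel: "equiv {f. continuous_map X Y f} (homotopy_rel X Y)"
proof (rule equivI)
  show "homotopy_rel X Y \<subseteq> {f. continuous_map X Y f} \<times> {f. continuous_map X Y f}"
    using homotopic_with_imp_continuous_maps unfolding homotopy_rel_def by blast
  show "refl_on {f. continuous_map X Y f} (homotopy_rel X Y)"
    by (simp add: homotopy_rel_def refl_on_def)
  show "sym (homotopy_rel X Y)"
    unfolding homotopy_rel_def sym_def using homotopic_with_symD by blast
  show "trans (homotopy_rel X Y)"
    unfolding homotopy_rel_def trans_def using homotopic_with_trans by blast
qed

text \<open>The map \<open>[X, Y] \<rightarrow> [X, Z]\<close> induced by \<open>j : Y \<rightarrow> Z\<close>. The union is over equal classes when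
  \<open>j\<close> is continuous, as the lemma shows.\<close>

definition induced_map ::
  "('b \<Rightarrow> 'c) \<Rightarrow> 'a topology \<Rightarrow> 'c topology \<Rightarrow> ('a \<Rightarrow> 'b) set \<Rightarrow> ('a \<Rightarrow> 'c) set" where
  "induced_map j X Z c = (\<Union>f\<in>c. homotopy_rel X Z `` {j \<circ> f})"

lemma induced_map_class:
  assumes "continuous_map Y Z j" "continuous_map X Y f"
  shows "induced_map j X Z (homotopy_rel X Y `` {f}) = homotopy_rel X Z `` {j \<circ> f}"
proof -
  have "homotopy_rel X Z `` {j \<circ> g} = homotopy_rel X Z `` {j \<circ> f}"
    if "homotopic_with (\<lambda>_. True) X Y f g" for g
  proof (rule equiv_class_eq[OF equiv_homotopy_rel])
    have "homotopic_with (\<lambda>_. True) X Z (j \<circ> g) (j \<circ> f)"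
      by (rule homotopic_with_compose_continuous_map_left[OF homotopic_with_symD[OF that] assms(1)])
        simp
    then show "(j \<circ> g, j \<circ> f) \<in> homotopy_rel X Z"
      by (simp add: homotopy_rel_def)
  qed
  then have "homotopy_rel X Z `` {j \<circ> g} = homotopy_rel X Z `` {j \<circ> f}"
    if "g \<in> homotopy_rel X Y `` {f}" for g
    using that by (simp add: homotopy_rel_def)
  moreover have "f \<in> homotopy_rel X Y `` {f}"
    using assms(2) by (simp add: homotopy_rel_def)
  ultimately show ?thesis
    unfolding induced_map_def by blast
qed

definition bounded_pos :: "nat \<Rightarrow> ((nat \<Rightarrow> long_ray) \<Rightarrow> long_line) set" where
  "bounded_pos n = {f. continuous_map (long_ray_power n) L_pos f \<and>
     (\<exists>z. f ` topspace (long_ray_power n) \<subseteq> pos_ray ` {0..z})}"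

definition bounded_neg :: "nat \<Rightarrow> ((nat \<Rightarrow> long_ray) \<Rightarrow> long_line) set" where
  "bounded_neg n = {f. continuous_map (long_ray_power n) L_neg f \<and>
     (\<exists>z. f ` topspace (long_ray_power n) \<subseteq> neg_ray ` {0..z})}"

definition half_classes ::
  "nat \<Rightarrow> (((nat \<Rightarrow> long_ray) \<Rightarrow> long_line) set + ((nat \<Rightarrow> long_ray) \<Rightarrow> long_line) set) set" where
  "half_classes n =
     homotopy_classes (long_ray_power n) L_pos <+> homotopy_classes (long_ray_power n) L_neg"

text \<open>Bounded maps form one homotopy class on each side, which the theorem asserts, so this is an
  equivalence relation on \<^term>\<open>half_classes n\<close>.\<close>

definition bounded_glue ::
  "nat \<Rightarrow> (((nat \<Rightarrow> long_ray) \<Rightarrow> long_line) set + ((nat \<Rightarrow> long_ray) \<Rightarrow> long_line) set) rel" where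
  "bounded_glue n = Id_on (half_classes n) \<union>
     {(Inl (bounded_pos n), Inr (bounded_neg n)), (Inr (bounded_neg n), Inl (bounded_pos n))}"

definition inclusion_map ::
  "nat \<Rightarrow> ((nat \<Rightarrow> long_ray) \<Rightarrow> long_line) set + ((nat \<Rightarrow> long_ray) \<Rightarrow> long_line) set
     \<Rightarrow> ((nat \<Rightarrow> long_ray) \<Rightarrow> long_line) set" where
  "inclusion_map n = case_sum (induced_map (\<lambda>y. y) (long_ray_power n) euclidean)
     (induced_map (\<lambda>y. y) (long_ray_power n) euclidean)"

section \<open>Signed coordinates\<close>

definition signed_coords :: "nat \<Rightarrow> int set" where
  "signed_coords n = int ` {1..n} \<union> (\<lambda>i. - int i) ` {1..n}"

definition admissible :: "nat \<Rightarrow> int set \<Rightarrow> bool" where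
  "admissible n I \<longleftrightarrow> I \<subseteq> signed_coords n \<and> (\<forall>i\<in>{1..n}. \<not> (int i \<in> I \<and> - int i \<in> I))"

definition admissible_sets :: "nat \<Rightarrow> int set set" where
  "admissible_sets n = {I. admissible n I}"

definition antichain :: "'a set set \<Rightarrow> bool" where
  "antichain A \<longleftrightarrow> (\<forall>I\<in>A. \<forall>J\<in>A. I \<noteq> J \<longrightarrow> \<not> I \<subseteq> J)"

end

theory Submission
  imports Defs
begin

text \<open>The ordinals \<open>pt c\<close> form a closed cofinal subset of the long ray, and clubs of ordinals are closed
  under countable intersections. A continuous map from a ray to the long ray is therefore either bounded
  or fixes a club of ordinals, and by connectedness and separability this alternative is uniform in
  parameters ranging over compact intervals. Consequently a map \<open>R\<^sup>n \<rightarrow> R\<close> is controlled by the upward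
  closed set of coordinate faces \<open>J\<close> on whose diagonal it is unbounded: if every face unbounded for \<open>f\<close>
  is unbounded for \<open>g\<close>, then \<open>f\<close> is bounded on the sublevel sets of \<open>g\<close>. Two maps that are bounded on
  each other's sublevel sets are homotopic, because a club of ordinals cuts the long ray into real
  intervals in which their values can be joined linearly. So homotopy classes correspond to
  upward closed families of faces, that is, to antichains; for \<open>L\<^sup>n\<close> this is applied on each orthant.

  For maps \<open>f\<close> from \<open>R\<^sup>n\<close> to the long line, the positive and the negative part of \<open>f\<close> cannot both fix
  a club on the full diagonal, so one of them is bounded and can be contracted to \<open>0\<close>.\<close>

section \<open>Ordinals in the long ray and the club filter\<close>

text \<open>The obstacle is that the long ray has no global real coordinate: only proper initial
  segments embed in the reals, and the embeddings chosen for different segments need not be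
  compatible. Straight-line homotopies therefore exist only below a fixed ordinal, and joining two
  maps requires cofinally many ordinals that cut both maps at the same places. Control of sublevel
  sets is what produces these ordinals.

  Limits are taken along sequences. Almost every ordinal \<open>c\<close>, in the sense of
  \<open>club\<close>, is approached by a sequence \<open>d k\<close> such that whatever is chosen
  at stage \<open>d k\<close> within a prescribed bound stays below \<open>c\<close>. Different
  choices made along the same sequence then converge to the same \<open>pt c\<close>, and continuity
  forces their values to agree in the limit.

  In several variables a sequence of points may escape in some coordinates and stay bounded in
  others. The escaping coordinates are pushed onto a common diagonal, the others converge along a
  subsequence, and the limit lies on a translate of a coordinate face. This is why diagonals of
  faces detect everything.\<close>

lemma omega1_countable_bounded:
  assumes "countable (A :: omega1 set)"
  shows "\<exists>b. \<forall>a\<in>A. a < b"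
proof (rule ccontr)
  assume "\<not> ?thesis"
  then have "UNIV = (\<Union>a\<in>A. {..a})"
    by (force simp: not_less)
  moreover have "countable {..a}" for a :: omega1
  proof -
    have "{..a} = insert a {..<a}" by auto
    then show ?thesis using countable_lessThan_omega1[of a] by simp
  qed
  ultimately show False
    using assms uncountable_omega1 by (metis countable_UN)
qed

definition pt :: "omega1 \<Rightarrow> long_ray" where
  "pt c = Abs_long_ray (c, 0)"

definition idx :: "long_ray \<Rightarrow> omega1" where
  "idx x = fst (Rep_long_ray x)"

definition frc :: "long_ray \<Rightarrow> real" where
  "frc x = snd (Rep_long_ray x)"

lemma frc_bounds: "0 \<le> frc x" "frc x < 1"
  using Rep_long_ray[of x] by (auto simp: frc_def mem_Times_iff)

lemma less_long_ray_iff: "x < y \<longleftrightarrow> idx x < idx y \<or> idx x = idx y \<and> frc x < frc y"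
  by (simp add: less_long_ray_def idx_def frc_def)

lemma long_ray_exists:
  assumes "0 \<le> t" "t < 1"
  shows "\<exists>x. idx x = c \<and> frc x = t"
  using assms by (intro exI[of _ "Abs_long_ray (c, t)"]) (simp add: idx_def frc_def Abs_long_ray_inverse)

lemma idx_pt [simp]: "idx (pt c) = c" and frc_pt [simp]: "frc (pt c) = 0"
  by (simp_all add: pt_def idx_def frc_def Abs_long_ray_inverse)

lemma less_pt_iff: "x < pt c \<longleftrightarrow> idx x < c"
  using frc_bounds(1)[of x] by (auto simp: less_long_ray_iff)

lemma pt_le_iff: "pt c \<le> x \<longleftrightarrow> c \<le> idx x"
  using less_pt_iff[of x c] by (simp add: not_less[symmetric])

lemma pt_less_pt [simp]: "pt c < pt d \<longleftrightarrow> c < d"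
  by (simp add: less_pt_iff)

lemma pt_le_pt [simp]: "pt c \<le> pt d \<longleftrightarrow> c \<le> d"
  by (simp add: pt_le_iff)

lemma exists_gt_omega1: "\<exists>b. (a :: omega1) < b"
  using omega1_countable_bounded[of "{a}"] by auto

lemma exists_pt_gt: "\<exists>b. x < pt b"
  using exists_gt_omega1 by (auto simp: less_pt_iff)

text \<open>The first conjunct excludes the least ordinal, for which closure is vacuous. That
  \<open>c\<close> is a limit is not built in; a function \<open>h\<close> with
  \<open>d < h d\<close> enforces it.\<close>

definition closed_under :: "(omega1 \<Rightarrow> omega1) \<Rightarrow> omega1 \<Rightarrow> bool" where
  "closed_under h c \<longleftrightarrow> (\<exists>d. d < c) \<and> (\<forall>d<c. h d < c)"

text \<open>Iterating a majorant of \<open>h\<close> countably often stays bounded. The least strict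
  upper bound \<open>c\<close> of the iterates is closed: by minimality each \<open>d < c\<close> is
  at most some iterate \<open>s k\<close>, so \<open>h d\<close> lies below the next one.\<close>

lemma closed_under_exists: "\<exists>c. closed_under h c"
proof -
  have "\<exists>b. d < b \<and> (\<forall>e\<le>d. h e < b)" for d
  proof -
    have "{..d} = insert d {..<d}" by auto
    then have "countable {..d}" using countable_lessThan_omega1[of d] by simp
    then have "countable (insert d (h ` {..d}))" by simp
    from omega1_countable_bounded[OF this] show ?thesis by auto
  qed
  then obtain H where H: "\<And>d. d < H d" "\<And>d e. e \<le> d \<Longrightarrow> h e < H d" by metis
  define s where "s = rec_nat undefined (\<lambda>_. H)"
  have s: "s (Suc k) = H (s k)" for k by (simp add: s_def)
  define c where "c = (LEAST b. \<forall>k. s k < b)"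
  have "\<exists>b. \<forall>k. s k < b"
    using omega1_countable_bounded[of "range s"] by auto
  then have c: "s k < c" for k
    unfolding c_def by (rule allE[OF LeastI_ex])
  have "h d < c" if "d < c" for d
  proof -
    have "\<not> (\<forall>k. s k < d)"
      using not_less_Least[of d "\<lambda>b. \<forall>k. s k < b"] that unfolding c_def by blast
    then obtain k where "d \<le> s k" by (auto simp: not_less)
    then have "h d < s (Suc k)" using H(2) s by simp
    then show ?thesis using c less_trans by blast
  qed
  then show ?thesis using c unfolding closed_under_def by blast
qed

text \<open>The club filter. Every club contains a set of the form \<open>{c. closed_under h c}\<close>, and for these
  sets countable intersections amount to pointwise suprema of the functions \<open>h\<close>.\<close>

definition club :: "omega1 filter" where
  "club = (INF h. principal {c. closed_under h c})"

lemma eventually_club_iff: "eventually P club \<longleftrightarrow> (\<exists>h. \<forall>c. closed_under h c \<longrightarrow> P c)"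
proof -
  have "\<exists>h\<in>UNIV. principal {c. closed_under h c} \<le>
      inf (principal {c. closed_under h1 c}) (principal {c. closed_under h2 c})" for h1 h2
    by (rule bexI[of _ "\<lambda>d. max (h1 d) (h2 d)"]) (auto simp: closed_under_def)
  then show ?thesis
    unfolding club_def by (subst eventually_INF_base) (auto simp: eventually_principal)
qed

lemma club_neq_bot [simp]: "club \<noteq> bot"
  unfolding trivial_limit_def eventually_club_iff using closed_under_exists by blast

lemma eventually_closed_under: "eventually (closed_under h) club"
  unfolding eventually_club_iff by blast

lemma eventually_club_gt: "eventually (\<lambda>c. a < c) club"
  unfolding eventually_club_iff by (rule exI[of _ "\<lambda>_. a"]) (auto simp: closed_under_def)

lemma eventually_club_countable:
  assumes "countable I" "\<And>i. i \<in> I \<Longrightarrow> eventually (P i) club"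
  shows "eventually (\<lambda>c. \<forall>i\<in>I. P i c) club"
proof -
  obtain h where h: "\<And>i c. i \<in> I \<Longrightarrow> closed_under (h i) c \<Longrightarrow> P i c"
    using assms(2) unfolding eventually_club_iff by metis
  have "\<exists>b. \<forall>i\<in>I. h i d < b" for d
    using omega1_countable_bounded[of "(\<lambda>i. h i d) ` I"] assms(1) by auto
  then obtain H where H: "\<And>i d. i \<in> I \<Longrightarrow> h i d < H d" by metis
  have "closed_under (h i) c" if "i \<in> I" "closed_under H c" for i c
    using that H unfolding closed_under_def by (meson less_trans)
  then show ?thesis unfolding eventually_club_iff using h by blast
qed

text \<open>Convergence to \<open>c\<close> from strictly below, in the form that lets anything
  squeezed between \<open>pt (d k)\<close> and \<open>pt c\<close> converge to
  \<open>pt c\<close>.\<close>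

definition cofinal_seq :: "(nat \<Rightarrow> omega1) \<Rightarrow> omega1 \<Rightarrow> bool" where
  "cofinal_seq d c \<longleftrightarrow> (\<forall>k. d k < c) \<and> (\<forall>e<c. \<forall>\<^sub>F k in sequentially. e < d k)"

text \<open>The function \<open>B\<close> is a budget: a choice made at stage \<open>d k\<close>
  that lies between \<open>d k\<close> and \<open>B (d k)\<close> stays below \<open>c\<close> and
  so converges to the same limit as \<open>d k\<close>. Such sequences exist because
  \<open>{..<c}\<close> is countable.\<close>

lemma eventually_club_cofinal:
  "eventually (\<lambda>c. \<exists>d. cofinal_seq d c \<and> (\<forall>k. B (d k) < c)) club"
proof -
  obtain s :: "omega1 \<Rightarrow> omega1" where s: "\<And>a. a < s a" using exists_gt_omega1 by metis
  have "\<exists>d. cofinal_seq d c \<and> (\<forall>k. B (d k) < c)" if "closed_under s c" "closed_under B c" for c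
  proof -
    let ?A = "{..<c}"
    have ne: "?A \<noteq> {}" using that by (auto simp: closed_under_def)
    define e where "e = from_nat_into ?A"
    have e: "range e = ?A" unfolding e_def
      using ne countable_lessThan_omega1 by (simp add: range_from_nat_into)
    \<comment> \<open>The maximum with the next element of the enumeration \<open>e\<close> of
      \<open>{..<c}\<close> makes the sequence cofinal, \<open>s\<close> makes it strictly
      increasing, and closure of \<open>c\<close> under \<open>s\<close> keeps it below
      \<open>c\<close>.\<close>
    define d where "d = rec_nat (s (e 0)) (\<lambda>k x. s (max x (e (Suc k))))"
    have d0: "d 0 = s (e 0)" and dS: "\<And>k. d (Suc k) = s (max (d k) (e (Suc k)))"
      by (simp_all add: d_def)
    have elt: "e k < c" for k using e by auto
    have dlt: "d k < c" for k
      using that(1) elt by (induction k) (auto simp: d0 dS closed_under_def)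
    have "d k < d (Suc k)" for k using s[of "max (d k) (e (Suc k))"] by (simp add: dS)
    then have mono: "d k \<le> d l" if "k \<le> l" for k l
      using that by (meson lift_Suc_mono_le less_imp_le)
    have ed: "e k < d k" for k
      using s[of "max (d (k-1)) (e k)"] s[of "e 0"] by (cases k) (auto simp: d0 dS)
    have "\<forall>\<^sub>F k in sequentially. x < d k" if "x < c" for x
    proof -
      obtain k where "x = e k" using e \<open>x < c\<close> by auto
      then have "x < d l" if "l \<ge> k" for l
        using ed[of k] mono[OF that] by simp
      then show ?thesis by (auto simp: eventually_sequentially)
    qed
    then have "cofinal_seq d c" using dlt by (auto simp: cofinal_seq_def)
    moreover have "B (d k) < c" for k using that(2) dlt by (auto simp: closed_under_def)
    ultimately show ?thesis by blast
  qed
  then show ?thesis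
    using eventually_conj[OF eventually_closed_under[of s] eventually_closed_under[of B]]
    by (auto elim: eventually_mono)
qed

lemma cofinal_seq_tendsto:
  assumes "cofinal_seq d c" "\<And>k. pt (d k) \<le> x k" "\<And>k. x k \<le> pt c"
  shows "x \<longlonglongrightarrow> pt c"
proof (rule order_tendstoI)
  fix a assume "a < pt c"
  then have "\<forall>\<^sub>F k in sequentially. idx a < d k"
    using assms(1) by (simp add: cofinal_seq_def less_pt_iff)
  then show "\<forall>\<^sub>F k in sequentially. a < x k"
    by eventually_elim (metis less_pt_iff assms(2) less_le_trans)
next
  fix a assume "pt c < a"
  then show "\<forall>\<^sub>F k in sequentially. x k < a"
    using le_less_trans[OF assms(3)] by (intro always_eventually) blast
qed

lemma cofinal_seq_tendsto_pt: "cofinal_seq d c \<Longrightarrow> (\<lambda>k. pt (d k)) \<longlonglongrightarrow> pt c"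
  by (rule cofinal_seq_tendsto) (auto simp: cofinal_seq_def less_imp_le)

section \<open>Order charts identifying initial segments with real intervals\<close>

definition is_chart :: "omega1 \<Rightarrow> (long_ray \<Rightarrow> real) \<Rightarrow> (real \<Rightarrow> long_ray) \<Rightarrow> real \<Rightarrow> bool" where
  "is_chart c \<phi> \<theta> S \<longleftrightarrow>
     (\<forall>x<pt c. \<phi> x \<in> {0..<S} \<and> \<theta> (\<phi> x) = x) \<and>
     (\<forall>s\<in>{0..<S}. \<theta> s < pt c \<and> \<phi> (\<theta> s) = s) \<and>
     (\<forall>y<pt c. \<forall>x<y. \<phi> x < \<phi> y) \<and>
     continuous_on {..<pt c} \<phi> \<and> continuous_on {0..<S} \<theta>"

text \<open>Only countably many ordinals lie below \<open>c\<close>, so the unit interval sitting at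
  \<open>b\<close> can be given a positive length \<open>w b\<close> with finite total.
  \<open>W b\<close> is the total length before \<open>b\<close>, and \<open>\<phi>\<close> lays the
  rescaled intervals end to end, filling \<open>{0..<W c}\<close>. Continuity in both directions is
  read off from the order, since \<open>\<phi>\<close> is an increasing bijection.\<close>

lemma is_chart_exists: "\<exists>\<phi> \<theta> S. is_chart c \<phi> \<theta> S"
proof -
  define w :: "omega1 \<Rightarrow> real" where "w b = (1/2) ^ to_nat_on {..<c} b" for b
  define W where "W b = infsum w {..<b}" for b
  have w_pos: "0 < w b" for b by (simp add: w_def)
  have "(\<lambda>k. (1/2::real) ^ k) summable_on to_nat_on {..<c} ` {..<c}"
    by (rule summable_on_subset_banach[of _ UNIV])
      (auto intro!: norm_summable_imp_summable_on summable_geometric)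
  then have "((\<lambda>k. (1/2::real) ^ k) \<circ> to_nat_on {..<c}) summable_on {..<c}"
    by (subst (asm) summable_on_reindex) (auto intro: inj_on_to_nat_on countable_lessThan_omega1)
  then have w_sum_c: "w summable_on {..<c}"
    by (simp add: o_def w_def[abs_def])
  have w_sum: "w summable_on A" if "A \<subseteq> {..<c}" for A
    using summable_on_subset_banach[OF w_sum_c that] .
  have W_step: "W b + w b \<le> W b'" if "b < b'" "b' \<le> c" for b b'
  proof -
    have "W b + w b = infsum w ({..<b} \<union> {b})"
      unfolding W_def using that by (subst infsum_Un_disjoint) (auto intro!: w_sum)
    also have "\<dots> \<le> infsum w {..<b'}"
      using that w_pos by (intro infsum_mono2) (auto intro!: w_sum simp: less_imp_le)
    finally show ?thesis by (simp add: W_def)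
  qed
  have W_nonneg: "0 \<le> W b" for b
    unfolding W_def using w_pos by (intro infsum_nonneg) (auto simp: less_imp_le)
  \<comment> \<open>There is no gap at limit ordinals: the sum \<open>W b\<close> is approximated by
    finite partial sums, and the largest index of a suitable finite set serves as
    \<open>m\<close>.\<close>
  have W_approx: "\<exists>m<b. s < W m + w m" if "0 \<le> s" "s < W b" "b \<le> c" for s b
  proof -
    have "(sum w \<longlongrightarrow> W b) (finite_subsets_at_top {..<b})"
      unfolding W_def using has_sum_infsum[OF w_sum[of "{..<b}"]] that(3)
      by (auto simp: has_sum_def)
    then have "eventually (\<lambda>F. s < sum w F) (finite_subsets_at_top {..<b})"
      using that(2) by (rule order_tendstoD)
    then obtain F where F: "finite F" "F \<subseteq> {..<b}" "s < sum w F"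
      by (auto simp: eventually_finite_subsets_at_top)
    then have "F \<noteq> {}" using that(1) by auto
    then have m: "Max F \<in> F" using F by simp
    then have mb: "Max F < b" using F(2) by auto
    have "sum w F = infsum w F" using F by simp
    also have "infsum w F \<le> infsum w ({..<Max F} \<union> {Max F})"
      using F mb that w_pos
      by (intro infsum_mono2) (auto intro!: w_sum simp: less_imp_le intro: le_neq_trans)
    also have "\<dots> = W (Max F) + w (Max F)"
      unfolding W_def using mb that by (subst infsum_Un_disjoint) (auto intro!: w_sum)
    finally show ?thesis using F mb by (intro exI[of _ "Max F"]) auto
  qed
  define \<phi> where "\<phi> x = W (idx x) + frc x * w (idx x)" for x
  have frc_w: "0 \<le> frc x * w b" "frc x * w b < w b" for x b
    using frc_bounds[of x] w_pos[of b] by (auto intro: mult_nonneg_nonneg less_imp_le)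
  have \<phi>_lt: "\<phi> x < W b" if "idx x < b" "b \<le> c" for x b
    using W_step[OF that] frc_w(2)[of x "idx x"] unfolding \<phi>_def by linarith
  have \<phi>_mono: "\<phi> x < \<phi> y" if "x < y" "y < pt c" for x y
  proof (cases "idx x = idx y")
    case True
    then show ?thesis using that(1) w_pos by (simp add: \<phi>_def less_long_ray_iff)
  next
    case False
    then have "idx x < idx y" "idx y \<le> c"
      using that by (auto simp: less_long_ray_iff[of x] less_pt_iff)
    then have "\<phi> x < W (idx y)" by (rule \<phi>_lt)
    then show ?thesis using frc_w(1)[of y "idx y"] unfolding \<phi>_def[of y] by linarith
  qed
  have \<phi>_range: "\<phi> x \<in> {0..<W c}" if "x < pt c" for x
    using \<phi>_lt[of x c] that W_nonneg[of "idx x"] frc_w(1)[of x "idx x"]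
    by (auto simp: less_pt_iff \<phi>_def)
  have \<phi>_surj: "\<exists>x<pt c. \<phi> x = s" if "s \<in> {0..<W c}" for s
  proof -
    \<comment> \<open>The interval containing \<open>s\<close> is the first one whose right end
      exceeds \<open>s\<close>. If \<open>s\<close> lay to the left of it, \<open>W_approx\<close>
      would give an earlier one.\<close>
    define b where "b = (LEAST b. b < c \<and> s < W b + w b)"
    have "\<exists>b. b < c \<and> s < W b + w b" using W_approx[of s c] that by auto
    then have b: "b < c" "s < W b + w b"
      unfolding b_def by (metis (mono_tags, lifting) LeastI_ex)+
    have s0: "0 \<le> s" using that by simp
    have "\<not> s < W b"
    proof
      assume "s < W b"
      then obtain m where "m < b" "s < W m + w m" using W_approx[OF s0 _ less_imp_le[OF b(1)]] by blast
      then show False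
        using not_less_Least[of m "\<lambda>b. b < c \<and> s < W b + w b"] b unfolding b_def by auto
    qed
    then obtain x where "idx x = b" "frc x = (s - W b) / w b"
      using long_ray_exists[of "(s - W b) / w b" b] b w_pos[of b] by (auto simp: field_simps)
    then show ?thesis
      using b w_pos[of b] by (intro exI[of _ x]) (auto simp: less_pt_iff \<phi>_def)
  qed
  define \<theta> where "\<theta> = inv_into {..<pt c} \<phi>"
  have inj: "inj_on \<phi> {..<pt c}"
    by (rule linorder_inj_onI) (use \<phi>_mono in force)+
  have \<theta>\<phi>: "\<theta> (\<phi> x) = x" if "x < pt c" for x
    using inj that by (simp add: \<theta>_def)
  have im: "\<phi> ` {..<pt c} = {0..<W c}" using \<phi>_range \<phi>_surj by force
  have \<phi>\<theta>: "\<phi> (\<theta> s) = s" and \<theta>_lt: "\<theta> s < pt c" if "s \<in> {0..<W c}" for s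
    using that im f_inv_into_f[of s \<phi> "{..<pt c}"] inv_into_into[of s \<phi> "{..<pt c}"]
    unfolding \<theta>_def by auto
  have \<phi>_less: "\<phi> x < \<phi> y \<longleftrightarrow> x < y" if "x < pt c" "y < pt c" for x y
    using \<phi>_mono[of x y] \<phi>_mono[of y x] that by (metis less_irrefl less_trans linorder_cases)
  have cont\<phi>: "continuous_on {..<pt c} \<phi>"
    unfolding continuous_on_def
  proof (intro ballI order_tendstoI)
    fix x a assume x: "x \<in> {..<pt c}" and a: "a < \<phi> x"
    show "\<forall>\<^sub>F y in at x within {..<pt c}. a < \<phi> y"
    proof (cases "a < 0")
      case True
      then show ?thesis using \<phi>_range
        by (auto simp: eventually_at_filter intro!: always_eventually) (meson less_le_trans)
    next
      case False
      then have a': "a \<in> {0..<W c}" using a \<phi>_range[of x] x by auto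
      then have "\<theta> a < x" using \<phi>_less[of "\<theta> a" x] x a by (simp add: \<phi>\<theta> \<theta>_lt)
      then have "\<forall>\<^sub>F y in at x within {..<pt c}. \<theta> a < y"
        by (rule order_tendstoD(1)[OF tendsto_ident_at])
      moreover have "\<forall>\<^sub>F y in at x within {..<pt c}. y \<in> {..<pt c}"
        by (simp add: eventually_at_filter)
      ultimately show ?thesis
        by eventually_elim (use \<phi>_less[of "\<theta> a"] a' in \<open>simp add: \<phi>\<theta> \<theta>_lt\<close>)
    qed
  next
    fix x a assume x: "x \<in> {..<pt c}" and a: "\<phi> x < a"
    show "\<forall>\<^sub>F y in at x within {..<pt c}. \<phi> y < a"
    proof (cases "a < W c")
      case False
      then show ?thesis using \<phi>_range
        by (auto simp: eventually_at_filter intro!: always_eventually) (meson less_le_trans not_less)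
    next
      case True
      then have a': "a \<in> {0..<W c}" using a \<phi>_range[of x] x by auto
      then have "x < \<theta> a" using \<phi>_less[of x "\<theta> a"] x a by (simp add: \<phi>\<theta> \<theta>_lt)
      then have "\<forall>\<^sub>F y in at x within {..<pt c}. y < \<theta> a"
        by (rule order_tendstoD(2)[OF tendsto_ident_at])
      moreover have "\<forall>\<^sub>F y in at x within {..<pt c}. y \<in> {..<pt c}"
        by (simp add: eventually_at_filter)
      ultimately show ?thesis
        by eventually_elim (use \<phi>_less[of _ "\<theta> a"] a' in \<open>simp add: \<phi>\<theta> \<theta>_lt\<close>)
    qed
  qed
  have cont\<theta>: "continuous_on {0..<W c} \<theta>"
    unfolding continuous_on_def
  proof (intro ballI order_tendstoI)
    fix s a assume s: "s \<in> {0..<W c}" and a: "a < \<theta> s"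
    then have a': "a < pt c" using \<theta>_lt[of s] by simp
    then have "\<phi> a < s" using \<phi>_less[of a "\<theta> s"] s a by (simp add: \<phi>\<theta> \<theta>_lt)
    then have "\<forall>\<^sub>F y in at s within {0..<W c}. \<phi> a < y"
      by (rule order_tendstoD(1)[OF tendsto_ident_at])
    moreover have "\<forall>\<^sub>F y in at s within {0..<W c}. y \<in> {0..<W c}"
      by (simp add: eventually_at_filter)
    ultimately show "\<forall>\<^sub>F y in at s within {0..<W c}. a < \<theta> y"
    proof eventually_elim
      case (elim y)
      then show ?case using \<phi>_less[of a "\<theta> y"] a' by (simp add: \<phi>\<theta> \<theta>_lt)
    qed
  next
    fix s a assume s: "s \<in> {0..<W c}" and a: "\<theta> s < a"
    show "\<forall>\<^sub>F y in at s within {0..<W c}. \<theta> y < a"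
    proof (cases "a < pt c")
      case False
      then show ?thesis using \<theta>_lt
        by (auto simp: eventually_at_filter intro!: always_eventually)
          (meson atLeastLessThan_iff less_le_trans not_less)
    next
      case True
      then have "s < \<phi> a" using \<phi>_less[of "\<theta> s" a] s a by (simp add: \<phi>\<theta> \<theta>_lt)
      then have "\<forall>\<^sub>F y in at s within {0..<W c}. y < \<phi> a"
        by (rule order_tendstoD(2)[OF tendsto_ident_at])
      moreover have "\<forall>\<^sub>F y in at s within {0..<W c}. y \<in> {0..<W c}"
        by (simp add: eventually_at_filter)
      ultimately show ?thesis
      proof eventually_elim
        case (elim y)
        then show ?case using \<phi>_less[of "\<theta> y" a] True by (simp add: \<phi>\<theta> \<theta>_lt)
      qed
    qed
  qed
  show ?thesis
    by (intro exI[of _ \<phi>] exI[of _ \<theta>] exI[of _ "W c"])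
      (use \<phi>_range \<theta>\<phi> \<theta>_lt \<phi>\<theta> \<phi>_mono cont\<phi> cont\<theta> in \<open>auto simp: is_chart_def\<close>)
qed

lemma is_chartD:
  assumes "is_chart c \<phi> \<theta> S"
  shows "x < pt c \<Longrightarrow> 0 \<le> \<phi> x" "x < pt c \<Longrightarrow> \<phi> x < S" "x < pt c \<Longrightarrow> \<theta> (\<phi> x) = x"
    "0 \<le> s \<Longrightarrow> s < S \<Longrightarrow> \<theta> s < pt c" "0 \<le> s \<Longrightarrow> s < S \<Longrightarrow> \<phi> (\<theta> s) = s"
    "x < y \<Longrightarrow> y < pt c \<Longrightarrow> \<phi> x < \<phi> y"
    "continuous_on {..<pt c} \<phi>" "continuous_on {0..<S} \<theta>"
  using assms by (auto simp: is_chart_def)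

lemma is_chart_le:
  assumes "is_chart c \<phi> \<theta> S" "x < pt c" "y < pt c"
  shows "\<phi> x \<le> \<phi> y \<longleftrightarrow> x \<le> y"
  using is_chartD(6)[OF assms(1), of x y] is_chartD(6)[OF assms(1), of y x] assms(2,3)
  by (cases x y rule: linorder_cases) auto

lemma is_chart_between:
  assumes c: "is_chart c \<phi> \<theta> S" and x: "x < pt c" and y: "y < pt c"
    and s: "min (\<phi> x) (\<phi> y) \<le> s" "s \<le> max (\<phi> x) (\<phi> y)"
  shows "s \<in> {0..<S}" "min x y \<le> \<theta> s" "\<theta> s \<le> max x y"
proof -
  show S: "s \<in> {0..<S}"
    using s is_chartD(1,2)[OF c x] is_chartD(1,2)[OF c y] by (auto simp: min_def max_def split: if_splits)
  then have *: "\<theta> s < pt c" "\<phi> (\<theta> s) = s" using is_chartD(4,5)[OF c] by auto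
  show "min x y \<le> \<theta> s" "\<theta> s \<le> max x y"
    using s is_chart_le[OF c x *(1)] is_chart_le[OF c y *(1)] is_chart_le[OF c *(1) x]
      is_chart_le[OF c *(1) y] *(2) by (auto simp: min_def max_def split: if_splits)
qed

section \<open>Homotopies by interpolation in charts\<close>

lemma continuous_map_iff_tendsto:
  fixes f :: "'a \<Rightarrow> 'b::topological_space"
  shows "continuous_map X euclidean f \<longleftrightarrow> (\<forall>x\<in>topspace X. (f \<longlongrightarrow> f x) (nhdsin X x))"
  unfolding continuous_map_eq_topcontinuous_at topcontinuous_at_def tendsto_def
  by (auto simp: eventually_nhdsin)

text \<open>The homotopy interpolates linearly in charts. The charts are indexed by ordinals that \<open>f\<close> and
  \<open>g\<close> do not separate, and the index of a point is locally constant unless \<open>f\<close> and \<open>g\<close> agree there;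
  in the latter case continuity follows by squeezing.\<close>

lemma coarse_homotopy:
  fixes f g :: "'a \<Rightarrow> long_ray"
  assumes f: "continuous_map X euclidean f" and g: "continuous_map X euclidean g"
    and fg: "\<And>a. \<exists>b. \<forall>p\<in>topspace X. g p < pt a \<longrightarrow> f p < pt b"
    and gf: "\<And>a. \<exists>b. \<forall>p\<in>topspace X. f p < pt a \<longrightarrow> g p < pt b"
  obtains h where "continuous_map (prod_topology (top_of_set {0..1::real}) X) euclidean h"
    "\<And>p. p \<in> topspace X \<Longrightarrow> h (0, p) = f p" "\<And>p. p \<in> topspace X \<Longrightarrow> h (1, p) = g p"
    "\<And>t p. t \<in> {0..1} \<Longrightarrow> p \<in> topspace X \<Longrightarrow>
      min (f p) (g p) \<le> h (t, p) \<and> h (t, p) \<le> max (f p) (g p)"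
proof -
  define C where "C = {b. \<forall>p\<in>topspace X. g p < pt b \<longleftrightarrow> f p < pt b}"
  obtain B1 where B1: "\<And>a p. p \<in> topspace X \<Longrightarrow> g p < pt a \<Longrightarrow> f p < pt (B1 a)"
    using fg by metis
  obtain B2 where B2: "\<And>a p. p \<in> topspace X \<Longrightarrow> f p < pt a \<Longrightarrow> g p < pt (B2 a)"
    using gf by metis
  obtain s :: "omega1 \<Rightarrow> omega1" where s: "\<And>a. a < s a" using exists_gt_omega1 by metis
  have C: "\<exists>b\<in>C. x < pt b" for x
  proof -
    have "\<forall>\<^sub>F b in club. closed_under B1 b \<and> closed_under B2 b \<and> closed_under s b \<and> idx x < b"
      by (intro eventually_conj eventually_closed_under eventually_club_gt)
    from eventually_happens'[OF club_neq_bot this]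
    obtain b where b: "closed_under B1 b" "closed_under B2 b" "closed_under s b" "idx x < b"
      by blast
    \<comment> \<open>Closure under \<open>s\<close> makes \<open>b\<close> a limit. The bounds
      \<open>B1\<close> and \<open>B2\<close> speak about a smaller ordinal, so a value below
      \<open>pt b\<close> has to be placed below some \<open>pt d\<close> with \<open>d < b\<close>
      first.\<close>
    have *: "\<exists>d<b. y < pt d" if "y < pt b" for y
      using that s b(3) by (intro exI[of _ "s (idx y)"]) (auto simp: closed_under_def less_pt_iff)
    have "g p < pt b \<longleftrightarrow> f p < pt b" if p: "p \<in> topspace X" for p
    proof
      assume "g p < pt b"
      then obtain d where "d < b" "g p < pt d" using * by blast
      then have "f p < pt (B1 d)" "pt (B1 d) < pt b" using B1 p b(1) by (auto simp: closed_under_def)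
      then show "f p < pt b" by (rule less_trans)
    next
      assume "f p < pt b"
      then obtain d where "d < b" "f p < pt d" using * by blast
      then have "g p < pt (B2 d)" "pt (B2 d) < pt b" using B2 p b(2) by (auto simp: closed_under_def)
      then show "g p < pt b" by (rule less_trans)
    qed
    then show ?thesis using b(4) by (auto simp: C_def less_pt_iff)
  qed
  \<comment> \<open>Taking the least index prevents upward jumps near a point, since
    \<open>g p < pt b\<close> is an open condition. Membership in \<open>C\<close> puts
    \<open>f p\<close> below \<open>pt (\<gamma> p)\<close> as well.\<close>
  define \<gamma> where "\<gamma> p = (LEAST b. b \<in> C \<and> g p < pt b)" for p
  have "\<gamma> p \<in> C \<and> g p < pt (\<gamma> p)" for p
    unfolding \<gamma>_def by (rule LeastI_ex) (use C in blast)
  then have \<gamma>_C: "\<gamma> p \<in> C" and g\<gamma>: "g p < pt (\<gamma> p)" for p by auto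
  have \<gamma>_le: "\<gamma> p \<le> b" if "b \<in> C" "g p < pt b" for p b
    unfolding \<gamma>_def using that by (intro Least_le) auto
  have f\<gamma>: "f p < pt (\<gamma> p)" if "p \<in> topspace X" for p
    using \<gamma>_C[of p] g\<gamma>[of p] that by (auto simp: C_def)
  obtain \<Phi> \<Theta> \<Sigma> where ch: "\<And>c. is_chart c (\<Phi> c) (\<Theta> c) (\<Sigma> c)"
    using is_chart_exists by metis
  define u where "u c t p = (1 - t) * \<Phi> c (f p) + t * \<Phi> c (g p)" for c t p
  define h where "h z = \<Theta> (\<gamma> (snd z)) (u (\<gamma> (snd z)) (fst z) (snd z))" for z
  have u: "min (\<Phi> c (f p)) (\<Phi> c (g p)) \<le> u c t p" "u c t p \<le> max (\<Phi> c (f p)) (\<Phi> c (g p))"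
    if "t \<in> {0..1}" for c t p
  proof -
    have "min (\<Phi> c (f p)) (\<Phi> c (g p)) = (1-t) * min (\<Phi> c (f p)) (\<Phi> c (g p)) + t * min (\<Phi> c (f p)) (\<Phi> c (g p))"
      by (simp add: algebra_simps)
    also have "\<dots> \<le> u c t p" unfolding u_def using that by (intro add_mono mult_left_mono) auto
    finally show "min (\<Phi> c (f p)) (\<Phi> c (g p)) \<le> u c t p" .
    have "u c t p \<le> (1-t) * max (\<Phi> c (f p)) (\<Phi> c (g p)) + t * max (\<Phi> c (f p)) (\<Phi> c (g p))"
      unfolding u_def using that by (intro add_mono mult_left_mono) auto
    also have "\<dots> = max (\<Phi> c (f p)) (\<Phi> c (g p))" by (simp add: algebra_simps)
    finally show "u c t p \<le> max (\<Phi> c (f p)) (\<Phi> c (g p))" .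
  qed
  have h_between: "min (f p) (g p) \<le> h (t, p)" "h (t, p) \<le> max (f p) (g p)"
    if "t \<in> {0..1}" "p \<in> topspace X" for t p
    using is_chart_between(2,3)[OF ch f\<gamma>[OF that(2)] g\<gamma> u[OF that(1)]] by (auto simp: h_def)
  let ?Z = "prod_topology (top_of_set {0..1::real}) X"
  have tf: "((\<lambda>z. f (snd z)) \<longlongrightarrow> f (snd z)) (nhdsin ?Z z)" and
    tg: "((\<lambda>z. g (snd z)) \<longlongrightarrow> g (snd z)) (nhdsin ?Z z)" and
    tt: "(fst \<longlongrightarrow> fst z) (nhdsin ?Z z)" if "z \<in> topspace ?Z" for z
  proof -
    have "continuous_map ?Z euclidean (f \<circ> snd)" "continuous_map ?Z euclidean (g \<circ> snd)"
      using f g continuous_map_snd by (blast intro: continuous_map_compose)+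
    moreover have "continuous_map ?Z euclidean fst"
      using continuous_map_fst continuous_map_in_subtopology by blast
    ultimately show "((\<lambda>z. f (snd z)) \<longlongrightarrow> f (snd z)) (nhdsin ?Z z)"
      "((\<lambda>z. g (snd z)) \<longlongrightarrow> g (snd z)) (nhdsin ?Z z)" "(fst \<longlongrightarrow> fst z) (nhdsin ?Z z)"
      using that unfolding continuous_map_iff_tendsto o_def by blast+
  qed
  have ev: "\<forall>\<^sub>F z in nhdsin ?Z z. z \<in> topspace ?Z" if "z \<in> topspace ?Z" for z
    using that by (auto simp: eventually_nhdsin)
  have "(h \<longlongrightarrow> h z0) (nhdsin ?Z z0)" if z0: "z0 \<in> topspace ?Z" for z0
  proof (cases "f (snd z0) = g (snd z0)")
    case True
    have "snd z0 \<in> topspace X" "fst z0 \<in> {0..1}" using z0 by auto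
    then have h0: "h z0 = f (snd z0)" using h_between[of "fst z0" "snd z0"] True by auto
    show ?thesis
    proof (rule tendsto_sandwich)
      show "((\<lambda>z. min (f (snd z)) (g (snd z))) \<longlongrightarrow> h z0) (nhdsin ?Z z0)"
        using tendsto_min[OF tf[OF z0] tg[OF z0]] True h0 by simp
      show "((\<lambda>z. max (f (snd z)) (g (snd z))) \<longlongrightarrow> h z0) (nhdsin ?Z z0)"
        using tendsto_max[OF tf[OF z0] tg[OF z0]] True h0 by simp
      show "\<forall>\<^sub>F z in nhdsin ?Z z0. min (f (snd z)) (g (snd z)) \<le> h z"
        using ev[OF z0] by eventually_elim (use h_between in auto)
      show "\<forall>\<^sub>F z in nhdsin ?Z z0. h z \<le> max (f (snd z)) (g (snd z))"
        using ev[OF z0] by eventually_elim (use h_between in auto)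
    qed
  next
    case False
    define c where "c = \<gamma> (snd z0)"
    have z0X: "snd z0 \<in> topspace X" "fst z0 \<in> {0..1}" using z0 by auto
    note fc = f\<gamma>[OF z0X(1), folded c_def] and gc = g\<gamma>[of "snd z0", folded c_def]
    \<comment> \<open>The larger value at \<open>z0\<close> exceeds \<open>m\<close>, hence so does
      the larger value at nearby points, and their chart index lies strictly above \<open>m\<close>.
      As this index does not separate the two values at \<open>z0\<close>, it bounds both of them
      and cannot be smaller than \<open>c\<close>. With equal values at \<open>z0\<close> the strict
      inequality is lost, and the index may really drop nearby.\<close>
    define m where "m = min (f (snd z0)) (g (snd z0))"
    have evm: "\<forall>\<^sub>F z in nhdsin ?Z z0. m < max (f (snd z)) (g (snd z))"
      using False by (intro order_tendstoD(1)[OF tendsto_max[OF tf[OF z0] tg[OF z0]]])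
        (auto simp: m_def min_def max_def)
    have evg: "\<forall>\<^sub>F z in nhdsin ?Z z0. g (snd z) < pt c"
      using order_tendstoD(2)[OF tg[OF z0] gc] .
    have ev\<gamma>: "\<forall>\<^sub>F z in nhdsin ?Z z0. \<gamma> (snd z) = c"
      using ev[OF z0] evm evg
    proof eventually_elim
      case (elim z)
      then have zX: "snd z \<in> topspace X" by auto
      have "\<gamma> (snd z) \<le> c" using \<gamma>_le[OF _ elim(3)] \<gamma>_C by (simp add: c_def)
      moreover have "m < pt (\<gamma> (snd z))"
        using elim(2) f\<gamma>[OF zX] g\<gamma>[of "snd z"] by (auto simp: max_def split: if_splits)
      then have "g (snd z0) < pt (\<gamma> (snd z))"
        using \<gamma>_C[of "snd z"] z0X(1) by (auto simp: C_def m_def min_def split: if_splits)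
      then have "c \<le> \<gamma> (snd z)" unfolding c_def by (intro \<gamma>_le \<gamma>_C)
      ultimately show ?case by simp
    qed
    have evf: "\<forall>\<^sub>F z in nhdsin ?Z z0. f (snd z) < pt c"
      using order_tendstoD(2)[OF tf[OF z0] fc] .
    have "((\<lambda>z. \<Phi> c (f (snd z))) \<longlongrightarrow> \<Phi> c (f (snd z0))) (nhdsin ?Z z0)"
      by (rule continuous_on_tendsto_compose[OF is_chartD(7)[OF ch] tf[OF z0]])
        (use fc evf in auto)
    moreover have "((\<lambda>z. \<Phi> c (g (snd z))) \<longlongrightarrow> \<Phi> c (g (snd z0))) (nhdsin ?Z z0)"
      by (rule continuous_on_tendsto_compose[OF is_chartD(7)[OF ch] tg[OF z0]])
        (use gc evg in auto)
    ultimately have tu: "((\<lambda>z. u c (fst z) (snd z)) \<longlongrightarrow> u c (fst z0) (snd z0)) (nhdsin ?Z z0)"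
      unfolding u_def using tt[OF z0] by (intro tendsto_intros)
    have "((\<lambda>z. \<Theta> c (u c (fst z) (snd z))) \<longlongrightarrow> \<Theta> c (u c (fst z0) (snd z0))) (nhdsin ?Z z0)"
    proof (rule continuous_on_tendsto_compose[OF is_chartD(8)[OF ch] tu])
      show "u c (fst z0) (snd z0) \<in> {0..<\<Sigma> c}"
        by (rule is_chart_between(1)[OF ch fc gc u[OF z0X(2)]])
      show "\<forall>\<^sub>F z in nhdsin ?Z z0. u c (fst z) (snd z) \<in> {0..<\<Sigma> c}"
        using ev[OF z0] evf evg
        by eventually_elim (rule is_chart_between(1)[OF ch _ _ u], auto)
    qed
    then show ?thesis
      by (subst tendsto_cong[where g = "\<lambda>z. \<Theta> c (u c (fst z) (snd z))"])
        (use ev\<gamma> in \<open>auto elim: eventually_mono simp: h_def c_def\<close>)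
  qed
  then have "continuous_map ?Z euclidean h" by (simp add: continuous_map_iff_tendsto)
  moreover have "h (0, p) = f p" "h (1, p) = g p" if "p \<in> topspace X" for p
    using is_chartD(3)[OF ch f\<gamma>[OF that]] is_chartD(3)[OF ch g\<gamma>[of p]] by (auto simp: h_def u_def)
  ultimately show thesis using that h_between by blast
qed

section \<open>Bounded or fixing a club\<close>

text \<open>Suppose \<open>F\<close> is unbounded. If it also had small values arbitrarily far out,
  small and large values could be picked along two sequences with a common limit, against
  continuity; so \<open>F\<close> tends to infinity. At an ordinal compatible with the upper growth
  bound \<open>U\<close> and the lower growth bound \<open>L\<close>, the value is then squeezed to
  \<open>pt c\<close>.\<close>

lemma dichotomy_omega1:
  fixes F :: "omega1 \<Rightarrow> long_ray"
  assumes cont: "\<And>d c. (\<lambda>k. pt (d k)) \<longlonglongrightarrow> pt c \<Longrightarrow> (\<lambda>k. F (d k)) \<longlonglongrightarrow> F c"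
  shows "(\<exists>b. \<forall>c. F c \<le> pt b) \<or> (\<forall>\<^sub>F c in club. F c = pt c)"
proof (cases "\<exists>b. \<forall>c. F c \<le> pt b")
  case False
  have ub: "\<exists>e. \<forall>c<d. F c < pt e" for d
    using omega1_countable_bounded[of "(\<lambda>c. idx (F c)) ` {..<d}"] countable_lessThan_omega1[of d]
    by (auto simp: less_pt_iff)
  \<comment> \<open>Unboundedness survives on every tail, since the countably many earlier values
    have a common bound.\<close>
  have unb: "\<exists>c\<ge>e. pt d < F c" for d e
  proof (rule ccontr)
    assume "\<not> ?thesis"
    then have *: "F c \<le> pt d" if "c \<ge> e" for c using that by (auto simp: not_less)
    obtain e' where e': "\<And>c. c < e \<Longrightarrow> F c < pt e'" using ub by blast
    have "F c \<le> pt (max d e')" for c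
    proof (cases "c < e")
      case True
      then have "F c \<le> pt e'" using e' by (simp add: less_imp_le)
      also have "\<dots> \<le> pt (max d e')" by simp
      finally show ?thesis .
    next
      case False
      then have "F c \<le> pt d" using * by simp
      also have "\<dots> \<le> pt (max d e')" by simp
      finally show ?thesis .
    qed
    then show False using False by blast
  qed
  have lb: "\<exists>e. \<forall>c\<ge>e. pt d \<le> F c" for d
  proof (rule ccontr)
    assume "\<not> ?thesis"
    then have "\<forall>e. \<exists>c\<ge>e. F c < pt d" by (auto simp: not_le)
    then obtain x1 where x1: "\<And>e. e \<le> x1 e" "\<And>e. F (x1 e) < pt d" by metis
    obtain d' where d': "d < d'" using exists_gt_omega1 by blast
    obtain x2 :: "omega1 \<Rightarrow> omega1" where x2: "\<And>e. e \<le> x2 e" "\<And>e. pt d' < F (x2 e)" using unb[of _ d'] by metis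
    obtain c d0 where c: "cofinal_seq d0 c" "\<And>k. max (x1 (d0 k)) (x2 (d0 k)) < c"
      using eventually_happens'[OF club_neq_bot eventually_club_cofinal[of "\<lambda>e. max (x1 e) (x2 e)"]]
      by blast
    have "(\<lambda>k. F (x1 (d0 k))) \<longlonglongrightarrow> F c"
      by (intro cont cofinal_seq_tendsto[OF c(1)]) (use c(2) x1(1) in \<open>auto simp: less_imp_le\<close>)
    then have "F c \<le> pt d"
      by (rule LIMSEQ_le_const2) (use x1(2) in \<open>auto simp: less_imp_le\<close>)
    moreover have "(\<lambda>k. F (x2 (d0 k))) \<longlonglongrightarrow> F c"
      by (intro cont cofinal_seq_tendsto[OF c(1)]) (use c(2) x2(1) in \<open>auto simp: less_imp_le\<close>)
    then have "pt d' \<le> F c"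
      by (rule LIMSEQ_le_const) (use x2(2) in \<open>auto simp: less_imp_le\<close>)
    ultimately have "pt d' \<le> pt d" by (rule order_trans[rotated])
    then show False using d' by simp
  qed
  obtain U where U: "\<And>c d. c < d \<Longrightarrow> F c < pt (U d)" using ub by metis
  obtain L where L: "\<And>c d. c \<ge> L d \<Longrightarrow> pt d \<le> F c" using lb by metis
  have "\<forall>\<^sub>F c in club. (\<exists>d. cofinal_seq d c \<and> (\<forall>k. max (U (d k)) (L (d k)) < c)) \<and> closed_under U c"
    by (intro eventually_conj eventually_club_cofinal eventually_closed_under)
  then have "\<forall>\<^sub>F c in club. F c = pt c"
  proof eventually_elim
    case (elim c)
    then obtain d where d: "cofinal_seq d c" "\<And>k. max (U (d k)) (L (d k)) < c" by blast
    \<comment> \<open>\<open>U d'\<close> bounds the values strictly before \<open>d'\<close>, hence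
      the intermediate ordinal between \<open>d k\<close> and \<open>c\<close>.\<close>
    have "F (d k) \<le> pt c" for k
    proof -
      obtain d' where "d k < d'" "d' < c"
        using d(1) eventually_happens'[OF sequentially_bot, of "\<lambda>l. d k < d l"]
        unfolding cofinal_seq_def by metis
      then have "F (d k) < pt (U d')" "U d' < c" using U elim by (auto simp: closed_under_def)
      then show ?thesis by (metis less_trans less_imp_le pt_less_pt)
    qed
    moreover have "(\<lambda>k. F (d k)) \<longlonglongrightarrow> F c"
      by (intro cont cofinal_seq_tendsto_pt d)
    ultimately have "F c \<le> pt c"
      by (intro LIMSEQ_le_const2[of "\<lambda>k. F (d k)"]) auto
    moreover have "pt (d k) \<le> F c" for k
      using d(2)[of k] by (intro L) auto
    then have "pt c \<le> F c"
      by (intro LIMSEQ_le_const2[OF cofinal_seq_tendsto_pt[OF d(1)]]) auto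
    ultimately show "F c = pt c" by simp
  qed
  then show ?thesis ..
qed blast

lemma dichotomy_exclusive:
  assumes "\<forall>c. F c \<le> pt b" "\<forall>\<^sub>F c in club. F c = pt c"
  shows False
proof -
  have "\<forall>\<^sub>F c in club. False"
    using assms(2) eventually_club_gt[of b] by eventually_elim (use assms(1) in \<open>metis not_less pt_le_pt\<close>)
  then show False by simp
qed

text \<open>The times of the two kinds form closed sets \<open>T\<close> and \<open>T'\<close>,
  disjoint because \<open>X\<close> is nonempty, so connectedness leaves only one kind. Uniformity
  in \<open>t\<close> comes from a countable dense set: countably many bounds have a common bound,
  countably many clubs meet in a club, and continuity extends the result to all times. The index set
  \<open>X\<close> carries parameters that have been treated before, so the lemma can be
  iterated.\<close>

lemma dichotomy_parameter:
  fixes F :: "omega1 \<Rightarrow> 'x \<Rightarrow> real \<Rightarrow> long_ray"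
  assumes cont: "\<And>c x. x \<in> X \<Longrightarrow> continuous_on {0..s} (F c x)"
    and X: "X \<noteq> {}"
    and dich: "\<And>t. t \<in> {0..s} \<Longrightarrow>
      (\<exists>b. \<forall>c. \<forall>x\<in>X. F c x t \<le> pt b) \<or> (\<forall>\<^sub>F c in club. \<forall>x\<in>X. F c x t = pt c)"
  shows "(\<exists>b. \<forall>c. \<forall>x\<in>X. \<forall>t\<in>{0..s}. F c x t \<le> pt b) \<or>
    (\<forall>\<^sub>F c in club. \<forall>x\<in>X. \<forall>t\<in>{0..s}. F c x t = pt c)"
proof -
  define T where "T = {t\<in>{0..s}. \<exists>b. \<forall>c. \<forall>x\<in>X. F c x t \<le> pt b}"
  define T' where "T' = {t\<in>{0..s}. \<forall>\<^sub>F c in club. \<forall>x\<in>X. F c x t = pt c}"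
  have seq: "(\<lambda>k. F c x (\<tau> k)) \<longlonglongrightarrow> F c x t"
    if "x \<in> X" "\<tau> \<longlonglongrightarrow> t" "\<And>k. \<tau> k \<in> {0..s}" "t \<in> {0..s}" for \<tau> t c x
    by (rule continuous_on_tendsto_compose[OF cont[OF that(1)] that(2,4)]) (use that(3) in auto)
  have bdd: "\<exists>b. \<forall>t\<in>D. \<forall>c. \<forall>x\<in>X. F c x t \<le> pt b" if D: "countable D" "D \<subseteq> T" for D
  proof -
    obtain b where b: "\<And>t c x. t \<in> D \<Longrightarrow> x \<in> X \<Longrightarrow> F c x t \<le> pt (b t)"
      using D(2) unfolding T_def by (simp add: subset_iff) metis
    obtain b' where "\<And>t. t \<in> D \<Longrightarrow> b t < b'"
      using omega1_countable_bounded[of "b ` D"] D(1) by auto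
    then have "F c x t \<le> pt b'" if "t \<in> D" "x \<in> X" for t c x
      using b[OF that, of c] that by (meson order_trans less_imp_le pt_le_pt)
    then show ?thesis by blast
  qed
  have clb: "\<forall>\<^sub>F c in club. \<forall>t\<in>D. \<forall>x\<in>X. F c x t = pt c" if "countable D" "D \<subseteq> T'" for D
    by (rule eventually_club_countable[OF that(1)]) (use that(2) in \<open>auto simp only: T'_def\<close>)
  have lim_le: "\<forall>c. \<forall>x\<in>X. F c x t \<le> pt b"
    if "\<tau> \<longlonglongrightarrow> t" "\<And>k. \<tau> k \<in> {0..s}" "t \<in> {0..s}" "\<forall>k. \<forall>c. \<forall>x\<in>X. F c x (\<tau> k) \<le> pt b" for \<tau> t b
    using that(4) by (intro allI ballI LIMSEQ_le_const2[OF seq[OF _ that(1-3)]]) auto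
  have lim_eq: "\<forall>x\<in>X. F c x t = pt c"
    if "\<tau> \<longlonglongrightarrow> t" "\<And>k. \<tau> k \<in> {0..s}" "t \<in> {0..s}" "\<forall>k. \<forall>x\<in>X. F c x (\<tau> k) = pt c" for \<tau> t c
  proof
    fix x assume x: "x \<in> X"
    have "(\<lambda>k. F c x (\<tau> k)) = (\<lambda>k. pt c)" using that(4) x by auto
    then show "F c x t = pt c"
      using seq[OF x that(1-3), of c] by (simp add: tendsto_const_iff)
  qed
  have range: "t \<in> {0..s}" if "\<tau> \<longlonglongrightarrow> t" "\<And>k. \<tau> k \<in> {0..s}" for \<tau> t
    using closed_sequentially[OF closed_atLeastAtMost that(2,1)] .
  \<comment> \<open>The bounds may vary along the sequence, but there are only countably many of
    them.\<close>
  have cl: "closed T"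
    unfolding closed_sequential_limits
  proof (intro allI impI, elim conjE)
    fix \<tau> t assume \<tau>: "\<forall>k. \<tau> k \<in> T" "\<tau> \<longlonglongrightarrow> t"
    then have \<tau>': "\<And>k. \<tau> k \<in> {0..s}" by (auto simp: T_def)
    then have t: "t \<in> {0..s}" using range \<tau>(2) by blast
    obtain b where "\<forall>k. \<forall>c. \<forall>x\<in>X. F c x (\<tau> k) \<le> pt b"
      using bdd[of "range \<tau>"] \<tau>(1) by auto
    then show "t \<in> T" using lim_le[OF \<tau>(2) \<tau>' t] t unfolding T_def by blast
  qed
  have cl': "closed T'"
    unfolding closed_sequential_limits
  proof (intro allI impI, elim conjE)
    fix \<tau> t assume \<tau>: "\<forall>k. \<tau> k \<in> T'" "\<tau> \<longlonglongrightarrow> t"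
    then have \<tau>': "\<And>k. \<tau> k \<in> {0..s}" by (auto simp: T'_def)
    then have t: "t \<in> {0..s}" using range \<tau>(2) by blast
    have "\<forall>\<^sub>F c in club. \<forall>t\<in>range \<tau>. \<forall>x\<in>X. F c x t = pt c"
      using \<tau>(1) by (intro clb) auto
    then have "\<forall>\<^sub>F c in club. \<forall>x\<in>X. F c x t = pt c"
      by eventually_elim (rule lim_eq[OF \<tau>(2) \<tau>' t], auto)
    then show "t \<in> T'" using t by (simp add: T'_def)
  qed
  have disj: "T \<inter> T' = {}"
  proof (rule ccontr)
    assume "T \<inter> T' \<noteq> {}"
    then obtain t b where t: "\<forall>c. \<forall>x\<in>X. F c x t \<le> pt b" "\<forall>\<^sub>F c in club. \<forall>x\<in>X. F c x t = pt c"
      by (auto simp: T_def T'_def)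
    obtain x where "x \<in> X" using X by blast
    then show False
      using dichotomy_exclusive[of "\<lambda>c. F c x t" b] t(1) eventually_mono[OF t(2), of "\<lambda>c. F c x t = pt c"]
      by blast
  qed
  have un: "{0..s} \<subseteq> T \<union> T'" unfolding T_def T'_def using dich by blast
  have "T \<inter> {0..s} = {} \<or> T' \<inter> {0..s} = {}"
    using connected_closedD[OF connected_Icc[of 0 s], of T T'] disj un cl cl' by blast
  then have cases: "{0..s} \<subseteq> T \<or> {0..s} \<subseteq> T'" using un by blast
  obtain D where D: "countable D" "D \<subseteq> {0..s}" "{0..s} \<subseteq> closure D"
    using separable[of "{0..s}"] by blast
  have approx: "\<exists>\<tau>. (\<forall>k. \<tau> k \<in> D) \<and> \<tau> \<longlonglongrightarrow> t" if "t \<in> {0..s}" for t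
    using D(3) that closure_sequential by blast
  show ?thesis
    using cases
  proof
    assume "{0..s} \<subseteq> T"
    then obtain b where b: "\<forall>t\<in>D. \<forall>c. \<forall>x\<in>X. F c x t \<le> pt b" using bdd[of D] D by blast
    have "\<forall>c. \<forall>x\<in>X. F c x t \<le> pt b" if t: "t \<in> {0..s}" for t
    proof -
      obtain \<tau> where \<tau>: "\<And>k. \<tau> k \<in> D" "\<tau> \<longlonglongrightarrow> t" using approx[OF t] by blast
      show ?thesis by (rule lim_le[OF \<tau>(2) _ t]) (use \<tau>(1) D(2) b in blast)+
    qed
    then show ?thesis by blast
  next
    assume "{0..s} \<subseteq> T'"
    then have "\<forall>\<^sub>F c in club. \<forall>t\<in>D. \<forall>x\<in>X. F c x t = pt c" using clb[of D] D by blast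
    then have "\<forall>\<^sub>F c in club. \<forall>x\<in>X. \<forall>t\<in>{0..s}. F c x t = pt c"
    proof eventually_elim
      case (elim c)
      have "\<forall>x\<in>X. F c x t = pt c" if t: "t \<in> {0..s}" for t
      proof -
        obtain \<tau> where \<tau>: "\<And>k. \<tau> k \<in> D" "\<tau> \<longlonglongrightarrow> t" using approx[OF t] by blast
        show ?thesis by (rule lim_eq[OF \<tau>(2) _ t]) (use \<tau>(1) D(2) elim in blast)+
      qed
      then show ?case by blast
    qed
    then show ?thesis ..
  qed
qed

text \<open>Makes compactness, connectedness and separability of real intervals available for
  bounded pieces of the long ray.\<close>

lemma interval_parametrization:
  fixes a :: long_ray
  obtains \<theta> :: "real \<Rightarrow> long_ray" and s where
    "0 \<le> s" "continuous_on {0..s} \<theta>" "\<theta> ` {0..s} = {..a}"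
proof -
  obtain c where c: "a < pt c" using exists_pt_gt by blast
  obtain \<phi> \<theta> S where ch: "is_chart c \<phi> \<theta> S" using is_chart_exists by blast
  note S = is_chartD(1,2)[OF ch c]
  have "continuous_on {0..\<phi> a} \<theta>"
    by (rule continuous_on_subset[OF is_chartD(8)[OF ch]]) (use S in auto)
  moreover have "\<theta> t \<le> a" if "t \<in> {0..\<phi> a}" for t
    using is_chart_le[OF ch is_chartD(4)[OF ch, of t] c] is_chartD(5)[OF ch, of t] that S by auto
  moreover have "x \<in> \<theta> ` {0..\<phi> a}" if "x \<le> a" for x
  proof -
    have "x < pt c" using that c by simp
    then show ?thesis
      using is_chartD(1,3)[OF ch, of x] is_chart_le[OF ch, of x a] that c
      by (intro image_eqI[of _ _ "\<phi> x"]) auto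
  qed
  ultimately show thesis by (intro that[of "\<phi> a" \<theta>]) (use S in auto)
qed

text \<open>Bolzano-Weierstrass, one coordinate at a time: each coordinate is pulled back to a
  compact real interval and the subsequence is refined.\<close>

lemma bounded_subsequence:
  fixes p :: "nat \<Rightarrow> 'i \<Rightarrow> long_ray"
  assumes "finite M" "\<And>k j. j \<in> M \<Longrightarrow> p k j \<le> a"
  shows "\<exists>\<sigma> r. strict_mono \<sigma> \<and> (\<forall>j\<in>M. r j \<le> a \<and> (\<lambda>k. p (\<sigma> k) j) \<longlonglongrightarrow> r j)"
  using assms
proof (induction M)
  case empty
  show ?case by (intro exI[of _ "\<lambda>k. k"]) (auto simp: strict_mono_def)
next
  case (insert i M)
  then obtain \<sigma> r where \<sigma>: "strict_mono \<sigma>"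
    "\<And>j. j \<in> M \<Longrightarrow> r j \<le> a \<and> (\<lambda>k. p (\<sigma> k) j) \<longlonglongrightarrow> r j" by blast
  obtain \<theta> :: "real \<Rightarrow> long_ray" and s where \<theta>: "continuous_on {0..s} \<theta>" "\<theta> ` {0..s} = {..a}"
    by (rule interval_parametrization)
  have "\<exists>t\<in>{0..s}. p (\<sigma> k) i = \<theta> t" for k
    using insert.prems[of i] \<theta>(2) by blast
  then obtain t where t: "\<And>k. t k \<in> {0..s}" "\<And>k. p (\<sigma> k) i = \<theta> (t k)" by metis
  have "seq_compact {0..s}" by (simp add: compact_imp_seq_compact)
  then obtain l \<rho> where l: "l \<in> {0..s}" "strict_mono \<rho>" "(t \<circ> \<rho>) \<longlonglongrightarrow> l"
    using t(1) seq_compactE by metis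
  have "(\<lambda>k. \<theta> ((t \<circ> \<rho>) k)) \<longlonglongrightarrow> \<theta> l"
    by (rule continuous_on_tendsto_compose[OF \<theta>(1) l(3,1)]) (use t(1) in auto)
  then have "(\<lambda>k. p ((\<sigma> \<circ> \<rho>) k) i) \<longlonglongrightarrow> \<theta> l" by (simp add: t(2))
  moreover have "\<theta> l \<le> a" using \<theta>(2) l(1) by blast
  moreover have "(\<lambda>k. p ((\<sigma> \<circ> \<rho>) k) j) \<longlonglongrightarrow> r j" if "j \<in> M" for j
    using LIMSEQ_subseq_LIMSEQ[OF conjunct2[OF \<sigma>(2)[OF that]] l(2)] by (simp add: o_def)
  moreover have "strict_mono (\<lambda>k. \<sigma> (\<rho> k))" using \<sigma>(1) l(2) by (simp add: strict_mono_def)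
  ultimately show ?case
    using \<sigma>(2) insert.hyps by (intro exI[of _ "\<lambda>k. \<sigma> (\<rho> k)"] exI[of _ "r(i := \<theta> l)"]) auto
qed

text \<open>Points enter through \<open>restrict\<close>, so limits can be computed coordinatewise
  for functions with arbitrary values outside \<open>K\<close>. Sequences are enough because the
  arguments on faces pass to limits along a \<open>cofinal_seq\<close>.\<close>

definition seq_cont :: "'i set \<Rightarrow> (('i \<Rightarrow> long_ray) \<Rightarrow> long_ray) \<Rightarrow> bool" where
  "seq_cont K f \<longleftrightarrow> (\<forall>p q. (\<forall>i\<in>K. (\<lambda>k. p k i) \<longlonglongrightarrow> q i) \<longrightarrow>
     (\<lambda>k. f (restrict (p k) K)) \<longlonglongrightarrow> f (restrict q K))"

lemma seq_contD:
  assumes "seq_cont K f" "\<And>i. i \<in> K \<Longrightarrow> (\<lambda>k. p k i) \<longlonglongrightarrow> q i"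
  shows "(\<lambda>k. f (restrict (p k) K)) \<longlonglongrightarrow> f (restrict q K)"
  using assms unfolding seq_cont_def by blast

lemma continuous_map_imp_seq_cont:
  assumes f: "continuous_map (product_topology (\<lambda>_. euclidean) K) euclidean f"
  shows "seq_cont K f"
  unfolding seq_cont_def
proof (intro allI impI)
  fix p :: "nat \<Rightarrow> 'a \<Rightarrow> long_ray" and q assume pq: "\<forall>i\<in>K. (\<lambda>k. p k i) \<longlonglongrightarrow> q i"
  have "limitin (product_topology (\<lambda>_. euclidean) K) (\<lambda>k. restrict (p k) K) (restrict q K) sequentially"
    using pq by (auto simp: limitin_componentwise)
  from continuous_map_limit[OF f this]
  show "(\<lambda>k. f (restrict (p k) K)) \<longlonglongrightarrow> f (restrict q K)"
    by (simp add: o_def)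
qed

section \<open>Faces of a power of the long ray\<close>

definition face_point :: "'i set \<Rightarrow> 'i set \<Rightarrow> omega1 \<Rightarrow> ('i \<Rightarrow> long_ray) \<Rightarrow> 'i \<Rightarrow> long_ray" where
  "face_point K J c r = restrict (\<lambda>j. if j \<in> J then pt c else r j) K"

text \<open>Only the diagonal through the origin is tested. By \<open>face_bounded_iff\<close>, any
  translate with bounded remaining coordinates gives the same answer.\<close>

definition unbounded_on_face :: "'i set \<Rightarrow> (('i \<Rightarrow> long_ray) \<Rightarrow> long_ray) \<Rightarrow> 'i set \<Rightarrow> bool" where
  "unbounded_on_face K f J \<longleftrightarrow> \<not> (\<exists>b. \<forall>c. f (face_point K J c (\<lambda>_. 0)) \<le> pt b)"

text \<open>Induction frees one coordinate at a time: those in \<open>M\<close> range over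
  \<open>{..a}\<close>, the others are frozen at \<open>u\<close>. The step is
  \<open>dichotomy_parameter\<close> with the new coordinate as time and the earlier ones as
  \<open>X\<close>; it uses the induction hypothesis for a changed \<open>u\<close>, hence the
  generalisation.\<close>

lemma face_dichotomy:
  fixes a :: long_ray
  assumes f: "seq_cont K f" and "finite M"
  defines "X \<equiv> \<lambda>M u. {r. (\<forall>j\<in>M. r j \<le> a) \<and> (\<forall>j. j \<notin> M \<longrightarrow> r j = u j)}"
  shows "(\<exists>b. \<forall>c. \<forall>r\<in>X M u. f (face_point K J c r) \<le> pt b) \<or>
    (\<forall>\<^sub>F c in club. \<forall>r\<in>X M u. f (face_point K J c r) = pt c)"
  using assms(2)
proof (induction M arbitrary: u)
  case empty
  have "X {} u = {u}" by (auto simp: X_def)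
  moreover have "(\<exists>b. \<forall>c. f (face_point K J c u) \<le> pt b) \<or>
    (\<forall>\<^sub>F c in club. f (face_point K J c u) = pt c)"
    by (rule dichotomy_omega1) (auto simp: face_point_def intro!: seq_contD[OF f])
  ultimately show ?case by simp
next
  case (insert i M)
  obtain \<theta> :: "real \<Rightarrow> long_ray" and s where \<theta>: "0 \<le> s" "continuous_on {0..s} \<theta>" "\<theta> ` {0..s} = {..a}"
    by (rule interval_parametrization)
  have upd: "r(i := \<theta> t) \<in> X M (u(i := \<theta> t))" if "r \<in> X M u" for r t
    using that insert.hyps by (auto simp: X_def)
  have "(\<exists>b. \<forall>c. \<forall>r\<in>X M u. \<forall>t\<in>{0..s}. f (face_point K J c (r(i := \<theta> t))) \<le> pt b) \<or>
    (\<forall>\<^sub>F c in club. \<forall>r\<in>X M u. \<forall>t\<in>{0..s}. f (face_point K J c (r(i := \<theta> t))) = pt c)"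
  proof (rule dichotomy_parameter)
    fix c r
    have "(\<lambda>k. f (face_point K J c (r(i := \<theta> (\<tau> k))))) \<longlonglongrightarrow> f (face_point K J c (r(i := \<theta> t)))"
      if "t \<in> {0..s}" "\<forall>k. \<tau> k \<in> {0..s}" "\<tau> \<longlonglongrightarrow> t" for \<tau> t
    proof -
      have "(\<lambda>k. \<theta> (\<tau> k)) \<longlonglongrightarrow> \<theta> t"
        by (rule continuous_on_tendsto_compose[OF \<theta>(2) that(3,1)]) (use that(2) in auto)
      then show ?thesis unfolding face_point_def by (intro seq_contD[OF f]) auto
    qed
    then show "continuous_on {0..s} (\<lambda>t. f (face_point K J c (r(i := \<theta> t))))"
      unfolding continuous_on_sequentially o_def by blast
  next
    have "(\<lambda>j. if j \<in> M then min a (u j) else u j) \<in> X M u" by (simp add: X_def)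
    then show "X M u \<noteq> {}" by blast
  next
    fix t
    show "(\<exists>b. \<forall>c. \<forall>r\<in>X M u. f (face_point K J c (r(i := \<theta> t))) \<le> pt b) \<or>
      (\<forall>\<^sub>F c in club. \<forall>r\<in>X M u. f (face_point K J c (r(i := \<theta> t))) = pt c)"
      using insert.IH[of "u(i := \<theta> t)"]
    proof
      assume "\<exists>b. \<forall>c. \<forall>r\<in>X M (u(i := \<theta> t)). f (face_point K J c r) \<le> pt b"
      then show ?thesis using upd by blast
    next
      assume "\<forall>\<^sub>F c in club. \<forall>r\<in>X M (u(i := \<theta> t)). f (face_point K J c r) = pt c"
      then have "\<forall>\<^sub>F c in club. \<forall>r\<in>X M u. f (face_point K J c (r(i := \<theta> t))) = pt c"
        by eventually_elim (use upd in blast)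
      then show ?thesis ..
    qed
  qed
  moreover have "\<exists>r'\<in>X M u. \<exists>t\<in>{0..s}. r = r'(i := \<theta> t)" if r: "r \<in> X (insert i M) u" for r
  proof -
    obtain t where "t \<in> {0..s}" "r i = \<theta> t" 
    proof -
      have "r i \<in> \<theta> ` {0..s}" using r by (simp add: \<theta>(3) X_def)
      then show ?thesis using that by blast
    qed
    moreover have "r(i := u i) \<in> X M u" using r insert.hyps by (auto simp: X_def)
    moreover have "r = (r(i := u i))(i := r i)" by simp
    ultimately show ?thesis by metis
  qed
  ultimately show ?case
  proof (elim disj_forward)
    assume rep: "\<And>r. r \<in> X (insert i M) u \<Longrightarrow> \<exists>r'\<in>X M u. \<exists>t\<in>{0..s}. r = r'(i := \<theta> t)"
    show "\<exists>b. \<forall>c. \<forall>r\<in>X (insert i M) u. f (face_point K J c r) \<le> pt b"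
      if "\<exists>b. \<forall>c. \<forall>r\<in>X M u. \<forall>t\<in>{0..s}. f (face_point K J c (r(i := \<theta> t))) \<le> pt b"
      using that rep by blast
    show "\<forall>\<^sub>F c in club. \<forall>r\<in>X (insert i M) u. f (face_point K J c r) = pt c"
      if "\<forall>\<^sub>F c in club. \<forall>r\<in>X M u. \<forall>t\<in>{0..s}. f (face_point K J c (r(i := \<theta> t))) = pt c"
      using that by eventually_elim (use rep in blast)
  qed
qed

lemma face_point_cong:
  assumes "\<And>j. j \<in> K - J \<Longrightarrow> r j = r' j"
  shows "face_point K J c r = face_point K J c r'"
  using assms unfolding face_point_def by (intro restrict_ext) auto

text \<open>The uniform dichotomy holds on the whole box, and the origin, which belongs to every
  box, decides which alternative occurs.\<close>

lemma face_bounded_iff: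
  assumes f: "seq_cont K f" and K: "finite K"
  shows "\<not> unbounded_on_face K f J \<Longrightarrow>
      \<exists>b. \<forall>c r. (\<forall>j\<in>K-J. r j \<le> a) \<longrightarrow> f (face_point K J c r) \<le> pt b" (is "_ \<Longrightarrow> ?B")
    and "unbounded_on_face K f J \<Longrightarrow>
      \<forall>\<^sub>F c in club. \<forall>r. (\<forall>j\<in>K-J. r j \<le> a) \<longrightarrow> f (face_point K J c r) = pt c" (is "_ \<Longrightarrow> ?C")
proof -
  define X where "X = {r. (\<forall>j\<in>K-J. r j \<le> a) \<and> (\<forall>j. j \<notin> K-J \<longrightarrow> r j = (0::long_ray))}"
  have X: "\<exists>r'\<in>X. face_point K J c r = face_point K J c r'" if "\<forall>j\<in>K-J. r j \<le> a" for c r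
    by (rule bexI[of _ "\<lambda>j. if j \<in> K - J then r j else 0"])
      (use that in \<open>auto simp: X_def intro!: face_point_cong\<close>)
  have "(\<exists>b. \<forall>c. \<forall>r\<in>X. f (face_point K J c r) \<le> pt b) \<or>
      (\<forall>\<^sub>F c in club. \<forall>r\<in>X. f (face_point K J c r) = pt c)"
    using face_dichotomy[OF f finite_Diff[OF K], of J a "\<lambda>_. 0" J] unfolding X_def .
  then have BC: "?B \<or> ?C"
  proof (elim disj_forward)
    assume "\<exists>b. \<forall>c. \<forall>r\<in>X. f (face_point K J c r) \<le> pt b"
    then obtain b where b: "\<And>c r. r \<in> X \<Longrightarrow> f (face_point K J c r) \<le> pt b" by blast
    have "f (face_point K J c r) \<le> pt b" if "\<forall>j\<in>K-J. r j \<le> a" for c r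
      using X[OF that, of c] b[of _ c] by auto
    then show ?B by blast
  next
    assume "\<forall>\<^sub>F c in club. \<forall>r\<in>X. f (face_point K J c r) = pt c"
    then show ?C
    proof eventually_elim
      case (elim c)
      have "f (face_point K J c r) = pt c" if "\<forall>j\<in>K-J. r j \<le> a" for r
        using X[OF that, of c] elim by auto
      then show ?case by blast
    qed
  qed
  have "unbounded_on_face K f J" if ?C
  proof (rule ccontr)
    assume "\<not> unbounded_on_face K f J"
    then obtain b where b: "\<forall>c. f (face_point K J c (\<lambda>_. 0)) \<le> pt b"
      by (auto simp: unbounded_on_face_def)
    have "\<forall>\<^sub>F c in club. f (face_point K J c (\<lambda>_. 0)) = pt c"
      using that by eventually_elim (simp add: long_ray_zero_le)
    with b show False by (rule dichotomy_exclusive)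
  qed
  then show ?B if "\<not> unbounded_on_face K f J" using BC that by blast
  have "\<not> unbounded_on_face K f J" if B: ?B
  proof -
    obtain b where "\<forall>c r. (\<forall>j\<in>K-J. r j \<le> a) \<longrightarrow> f (face_point K J c r) \<le> pt b" using B by blast
    then have "\<forall>c. f (face_point K J c (\<lambda>_. 0)) \<le> pt b" using long_ray_zero_le by simp
    then show ?thesis unfolding unbounded_on_face_def by blast
  qed
  then show ?C if "unbounded_on_face K f J" using BC that by blast
qed

text \<open>Freeze the coordinates in \<open>J - I\<close> at \<open>d\<close> and pick
  \<open>g d > d\<close> with value \<open>pt (g d)\<close> when the coordinates in \<open>I\<close>
  are \<open>g d\<close>. Along a cofinal sequence of \<open>d\<close> both groups converge to
  \<open>c\<close>, so the limit is the diagonal of \<open>J\<close> and the value there is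
  \<open>pt c\<close>.\<close>

lemma unbounded_on_face_mono:
  assumes f: "seq_cont K f" and K: "finite K" and I: "unbounded_on_face K f I" and "I \<subseteq> J"
  shows "unbounded_on_face K f J"
proof (rule ccontr)
  assume "\<not> ?thesis"
  then obtain b where b: "\<forall>c. f (face_point K J c (\<lambda>_. 0)) \<le> pt b"
    by (auto simp: unbounded_on_face_def)
  define u where "u d = (\<lambda>j. if j \<in> J then pt d else 0)" for d
  have "\<exists>c>d. f (face_point K I c (u d)) = pt c" for d
  proof -
    have "u d j \<le> pt d" for j by (simp add: u_def long_ray_zero_le)
    then have "\<forall>\<^sub>F c in club. d < c \<and> f (face_point K I c (u d)) = pt c"
      using eventually_conj[OF eventually_club_gt[of d] face_bounded_iff(2)[OF f K I, of "pt d"]]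
      by (auto elim: eventually_mono)
    from eventually_happens'[OF club_neq_bot this] show ?thesis by blast
  qed
  then obtain g where g: "\<And>d. d < g d" "\<And>d. f (face_point K I (g d) (u d)) = pt (g d)" by metis
  have "\<forall>\<^sub>F c in club. f (face_point K J c (\<lambda>_. 0)) = pt c"
    using eventually_club_cofinal[of g]
  proof eventually_elim
    case (elim c)
    then obtain d where d: "cofinal_seq d c" "\<And>k. g (d k) < c" by blast
    have gl: "(\<lambda>k. pt (g (d k))) \<longlonglongrightarrow> pt c"
      by (rule cofinal_seq_tendsto[OF d(1)]) (use d(2) g(1) in \<open>auto simp: less_imp_le\<close>)
    have "(\<lambda>k. if i \<in> I then pt (g (d k)) else u (d k) i) \<longlonglongrightarrow> (if i \<in> J then pt c else 0)" for i
      using gl cofinal_seq_tendsto_pt[OF d(1)] \<open>I \<subseteq> J\<close>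
      by (cases "i \<in> I"; cases "i \<in> J") (auto simp: u_def)
    then have "(\<lambda>k. f (face_point K I (g (d k)) (u (d k)))) \<longlonglongrightarrow> f (face_point K J c (\<lambda>_. 0))"
      unfolding face_point_def by (intro seq_contD[OF f])
    with gl show ?case unfolding g(2) by (rule LIMSEQ_unique[rotated])
  qed
  with b show False by (rule dichotomy_exclusive)
qed

text \<open>A failure yields points with \<open>g\<close> bounded and \<open>f\<close> arbitrarily
  large. Such points are made to converge to the diagonal of a face \<open>J\<close>, where
  \<open>f\<close> takes the value \<open>pt c\<close> for almost all \<open>c\<close> while
  \<open>g\<close> stays at most \<open>pt a\<close>. This contradicts either the boundedness of
  \<open>f\<close> on \<open>J\<close> or the unboundedness of \<open>g\<close> there.\<close>

lemma bounded_on_sublevel: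
  assumes f: "seq_cont K f" and g: "seq_cont K g" and K: "finite K"
    and fg: "\<And>J. J \<subseteq> K \<Longrightarrow> unbounded_on_face K f J \<Longrightarrow> unbounded_on_face K g J"
  shows "\<exists>b. \<forall>p\<in>PiE K (\<lambda>_. UNIV). g p < pt a \<longrightarrow> f p < pt b"
proof (rule ccontr)
  assume "\<not> ?thesis"
  then have *: "\<forall>b. \<exists>p\<in>PiE K (\<lambda>_. UNIV). g p < pt a \<and> pt b \<le> f p" by (auto simp: not_less)
  define P where "P J a' b p \<longleftrightarrow> g (restrict p K) \<le> pt a \<and> pt b \<le> f (restrict p K) \<and> (\<forall>j\<in>K-J. p j \<le> a')"
    for J and a' :: long_ray and b p
  \<comment> \<open>\<open>J\<close> collects the coordinates that are allowed to escape, the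
    remaining ones being confined by a fixed \<open>a'\<close>. A minimal such set is chosen, so
    that all its coordinates have to escape.\<close>
  define Good where "Good = {J. J \<subseteq> K \<and> (\<exists>a'. \<forall>b. \<exists>p. P J a' b p)}"
  have "\<exists>p. P K 0 b p" for b
  proof -
    obtain p where p: "p \<in> PiE K (\<lambda>_. UNIV)" "g p < pt a" "pt b \<le> f p" using * by blast
    then show ?thesis by (intro exI[of _ p]) (simp add: P_def PiE_restrict[OF p(1)] less_imp_le)
  qed
  then have "K \<in> Good" unfolding Good_def by blast
  moreover have "finite Good" using K by (auto intro: finite_subset[of _ "Pow K"] simp: Good_def)
  ultimately obtain J where J: "J \<in> Good" and Jmin: "\<And>I. I \<in> Good \<Longrightarrow> I \<subseteq> J \<Longrightarrow> J = I"
    using finite_has_minimal[of Good] by blast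
  have JK: "J \<subseteq> K" using J by (simp add: Good_def)
  then have finJ: "finite J" using K finite_subset by blast
  obtain a' where a': "\<And>b. \<exists>p. P J a' b p" using J unfolding Good_def by blast
  \<comment> \<open>If coordinate \<open>i\<close> could stay below \<open>pt d\<close> for every
    \<open>b\<close>, it could be moved to the confined coordinates after enlarging
    \<open>a'\<close>, against minimality.\<close>
  have "\<exists>b. \<forall>p. P J a' b p \<longrightarrow> pt d \<le> p i" if "i \<in> J" for i d
  proof (rule ccontr)
    assume "\<not> ?thesis"
    then have **: "\<forall>b. \<exists>p. P J a' b p \<and> p i < pt d" by (auto simp: not_le)
    have "\<exists>p. P (J - {i}) (max a' (pt d)) b p" for b
    proof -
      obtain p where "P J a' b p" "p i < pt d" using ** by blast
      then have "P (J - {i}) (max a' (pt d)) b p" by (auto simp: P_def le_max_iff_disj)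
      then show ?thesis by blast
    qed
    then have "J - {i} \<in> Good" using JK unfolding Good_def by blast
    then show False using Jmin[of "J - {i}"] that by blast
  qed
  then obtain b where b: "\<And>i d p. i \<in> J \<Longrightarrow> P J a' (b i d) p \<Longrightarrow> pt d \<le> p i" by metis
  have "\<exists>p. P J a' d p \<and> (\<forall>i\<in>J. pt d \<le> p i)" for d
  proof -
    \<comment> \<open>\<open>P\<close> weakens as its ordinal decreases, so one \<open>B\<close>
      above \<open>d\<close> and all finitely many thresholds serves every coordinate of
      \<open>J\<close> at once.\<close>
    obtain B where B: "\<And>x. x \<in> insert d ((\<lambda>i. b i d) ` J) \<Longrightarrow> x < B"
      using omega1_countable_bounded[of "insert d ((\<lambda>i. b i d) ` J)"] finJ
      by (auto simp: countable_finite)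
    obtain p where p: "P J a' B p" using a' by blast
    have PB: "P J a' x p" if "x \<in> insert d ((\<lambda>i. b i d) ` J)" for x
      using p B[OF that] unfolding P_def by (meson less_imp_le order_trans pt_le_pt)
    then show ?thesis using b by (intro exI[of _ p]) auto
  qed
  then obtain p where p: "\<And>d. P J a' d (p d)" "\<And>d i. i \<in> J \<Longrightarrow> pt d \<le> p d i" by metis
  \<comment> \<open>The budget for \<open>eventually_club_cofinal\<close>: it traps the value of
    \<open>f\<close> and the escaping coordinates below \<open>c\<close>, forcing them all to
    converge to \<open>pt c\<close>.\<close>
  have "\<exists>e. f (restrict (p d) K) < pt e \<and> (\<forall>i\<in>J. p d i < pt e)" for d
    using omega1_countable_bounded[of "insert (idx (f (restrict (p d) K))) ((\<lambda>i. idx (p d i)) ` J)"] finJ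
    by (auto simp: less_pt_iff countable_finite)
  then obtain E where E: "\<And>d. f (restrict (p d) K) < pt (E d)" "\<And>d i. i \<in> J \<Longrightarrow> p d i < pt (E d)"
    by metis
  have ev: "\<forall>\<^sub>F c in club. \<exists>r. (\<forall>j\<in>K-J. r j \<le> a') \<and> f (face_point K J c r) = pt c \<and>
      g (face_point K J c r) \<le> pt a"
    using eventually_club_cofinal[of E]
  proof eventually_elim
    case (elim c)
    then obtain d where d: "cofinal_seq d c" "\<And>k. E (d k) < c" by blast
    have Ec: "x \<le> pt c" if "x < pt (E (d k))" for k x
      using that d(2)[of k] by (meson less_imp_le less_trans pt_less_pt)
    have fl: "(\<lambda>k. f (restrict (p (d k)) K)) \<longlonglongrightarrow> pt c"
      by (rule cofinal_seq_tendsto[OF d(1)]) (use p(1) Ec[OF E(1)] in \<open>auto simp: P_def\<close>)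
    have pl: "(\<lambda>k. p (d k) i) \<longlonglongrightarrow> pt c" if "i \<in> J" for i
      by (rule cofinal_seq_tendsto[OF d(1)]) (use p(2) Ec[OF E(2)] that in auto)
    obtain \<sigma> r where \<sigma>: "strict_mono \<sigma>"
      and r: "\<And>j. j \<in> K - J \<Longrightarrow> r j \<le> a' \<and> (\<lambda>k. p (d (\<sigma> k)) j) \<longlonglongrightarrow> r j"
      using bounded_subsequence[of "K - J" "\<lambda>k. p (d k)" a'] p(1) K unfolding P_def
      by (metis finite_Diff)
    have lim: "(\<lambda>k. p (d (\<sigma> k)) j) \<longlonglongrightarrow> (if j \<in> J then pt c else r j)" if "j \<in> K" for j
      using that r LIMSEQ_subseq_LIMSEQ[OF pl \<sigma>] by (simp add: o_def)
    have "(\<lambda>k. f (restrict (p (d (\<sigma> k))) K)) \<longlonglongrightarrow> f (face_point K J c r)"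
      unfolding face_point_def by (rule seq_contD[OF f lim])
    moreover have "(\<lambda>k. f (restrict (p (d (\<sigma> k))) K)) \<longlonglongrightarrow> pt c"
      using LIMSEQ_subseq_LIMSEQ[OF fl \<sigma>] by (simp add: o_def)
    ultimately have "f (face_point K J c r) = pt c" by (rule LIMSEQ_unique)
    moreover have "(\<lambda>k. g (restrict (p (d (\<sigma> k))) K)) \<longlonglongrightarrow> g (face_point K J c r)"
      unfolding face_point_def by (rule seq_contD[OF g lim])
    then have "g (face_point K J c r) \<le> pt a"
      by (rule LIMSEQ_le_const2) (use p(1) in \<open>auto simp: P_def\<close>)
    ultimately show ?case using r by blast
  qed
  show False
  proof (cases "unbounded_on_face K f J")
    case True
    have "\<forall>\<^sub>F c in club. False"
      using ev face_bounded_iff(2)[OF g K fg[OF JK True], of a'] eventually_club_gt[of a]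
    proof eventually_elim
      case (elim c)
      then obtain r where "\<forall>j\<in>K-J. r j \<le> a'" "g (face_point K J c r) \<le> pt a" by blast
      with elim(2,3) have "pt c \<le> pt a" by metis
      with elim(3) show False by simp
    qed
    then show False by simp
  next
    case False
    then obtain b where "\<forall>c r. (\<forall>j\<in>K-J. r j \<le> a') \<longrightarrow> f (face_point K J c r) \<le> pt b"
      using face_bounded_iff(1)[OF f K] by blast
    note b = this
    have "\<forall>\<^sub>F c in club. False"
      using ev eventually_club_gt[of b]
    proof eventually_elim
      case (elim c)
      then obtain r where "\<forall>j\<in>K-J. r j \<le> a'" "f (face_point K J c r) = pt c" by blast
      with b have "pt c \<le> pt b" by metis
      with elim(2) show False by simp
    qed
    then show False by simp
  qed
qed

section \<open>Faces and homotopies\<close>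

text \<open>The time of the homotopy is the parameter of \<open>dichotomy_parameter\<close>: being
  bounded on a diagonal cannot change along a connected interval.\<close>

lemma unbounded_on_face_homotopy_invariant:
  assumes h: "continuous_map (prod_topology (top_of_set {0..1::real}) X) euclidean h"
    and e: "continuous_map (product_topology (\<lambda>_. euclidean) K) X e" and K: "finite K"
  shows "unbounded_on_face K (\<lambda>x. h (0, e x)) J \<longleftrightarrow> unbounded_on_face K (\<lambda>x. h (1, e x)) J"
proof -
  let ?R = "product_topology (\<lambda>_. euclidean :: long_ray topology) K"
  \<comment> \<open>There is no further parameter here, so \<open>X\<close> becomes the one-element
    type \<open>unit\<close>.\<close>
  define F where "F c (x :: unit) t = h (t, e (face_point K J c (\<lambda>_. 0)))" for c x t
  have slice: "seq_cont K (\<lambda>x. h (t, e x))" if "t \<in> {0..1}" for t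
  proof (rule continuous_map_imp_seq_cont)
    have "continuous_map ?R (prod_topology (top_of_set {0..1::real}) X) (\<lambda>x. (t, e x))"
      using e that by (simp add: continuous_map_pairwise o_def)
    from continuous_map_compose[OF this h] show "continuous_map ?R euclidean (\<lambda>x. h (t, e x))"
      by (simp add: o_def)
  qed
  have "(\<exists>b. \<forall>c. \<forall>x\<in>UNIV. \<forall>t\<in>{0..1}. F c x t \<le> pt b) \<or>
    (\<forall>\<^sub>F c in club. \<forall>x\<in>UNIV. \<forall>t\<in>{0..1}. F c x t = pt c)"
  proof (rule dichotomy_parameter)
    fix c x
    have "face_point K J c (\<lambda>_. 0) \<in> topspace ?R" by (simp add: face_point_def)
    then have "e (face_point K J c (\<lambda>_. 0)) \<in> topspace X"
      using continuous_map_image_subset_topspace[OF e] by blast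
    then have "continuous_map (top_of_set {0..1::real}) (prod_topology (top_of_set {0..1::real}) X)
        (\<lambda>t. (t, e (face_point K J c (\<lambda>_. 0))))"
      by (simp add: continuous_map_pairwise o_def)
    from continuous_map_compose[OF this h] show "continuous_on {0..1} (F c x)"
      by (simp add: o_def F_def)
  next
    fix t :: real assume t: "t \<in> {0..1}"
    show "(\<exists>b. \<forall>c. \<forall>x\<in>UNIV. F c x t \<le> pt b) \<or> (\<forall>\<^sub>F c in club. \<forall>x\<in>UNIV. F c x t = pt c)"
    proof (cases "unbounded_on_face K (\<lambda>x. h (t, e x)) J")
      case True
      have "\<forall>\<^sub>F c in club. F c x t = pt c" for x
        using face_bounded_iff(2)[OF slice[OF t] K True, of 0] unfolding F_def
        by eventually_elim simp
      then show ?thesis by simp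
    qed (auto simp: unbounded_on_face_def F_def)
  qed simp
  then consider b where "\<forall>c. \<forall>t\<in>{0..1}. F c () t \<le> pt b"
    | "\<forall>\<^sub>F c in club. \<forall>t\<in>{0..1}. F c () t = pt c" by auto
  then show ?thesis
  proof cases
    case 1
    then have "\<not> unbounded_on_face K (\<lambda>x. h (t, e x)) J" if "t \<in> {0..1}" for t
      using that unfolding unbounded_on_face_def F_def by blast
    then show ?thesis by simp
  next
    case 2
    have "unbounded_on_face K (\<lambda>x. h (t, e x)) J" if t: "t \<in> {0..1}" for t
    proof (rule ccontr)
      assume "\<not> ?thesis"
      then obtain b where "\<forall>c. F c () t \<le> pt b" unfolding unbounded_on_face_def F_def by blast
      moreover have "\<forall>\<^sub>F c in club. F c () t = pt c" using 2 by eventually_elim (use t in blast)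
      ultimately show False by (rule dichotomy_exclusive)
    qed
    then show ?thesis by simp
  qed
qed

lemma homotopic_imp_same_faces:
  assumes "homotopic_with (\<lambda>_. True) X euclidean f g"
    and "continuous_map (product_topology (\<lambda>_. euclidean) K) X e" "finite K"
  shows "unbounded_on_face K (\<lambda>x. f (e x)) J \<longleftrightarrow> unbounded_on_face K (\<lambda>x. g (e x)) J"
proof -
  obtain h where h: "continuous_map (prod_topology (top_of_set {0..1::real}) X) euclidean h"
    and "\<And>x. h (0, x) = f x" "\<And>x. h (1, x) = g x"
    using assms(1) unfolding homotopic_with_def by blast
  then show ?thesis
    using unbounded_on_face_homotopy_invariant[OF h assms(2,3), of J] by simp
qed

text \<open>\<open>E\<close> is a finite family of maps whose images cover the space, such as the
  orthants of a power of the long line. Sublevel bounds are found on each piece, and finitely many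
  ordinals have a common bound.\<close>

lemma homotopy_of_same_faces:
  fixes f g :: "'a \<Rightarrow> long_ray" and E :: "(('i \<Rightarrow> long_ray) \<Rightarrow> 'a) set"
  assumes f: "continuous_map X euclidean f" and g: "continuous_map X euclidean g"
    and "finite E" "finite K"
    and e: "\<And>e. e \<in> E \<Longrightarrow> continuous_map (product_topology (\<lambda>_. euclidean) K) X e"
    and cover: "topspace X \<subseteq> (\<Union>e\<in>E. e ` PiE K (\<lambda>_. UNIV))"
    and same: "\<And>e J. e \<in> E \<Longrightarrow>
      unbounded_on_face K (\<lambda>x. f (e x)) J \<longleftrightarrow> unbounded_on_face K (\<lambda>x. g (e x)) J"
  obtains h where "continuous_map (prod_topology (top_of_set {0..1::real}) X) euclidean h"
    "\<And>p. p \<in> topspace X \<Longrightarrow> h (0, p) = f p" "\<And>p. p \<in> topspace X \<Longrightarrow> h (1, p) = g p"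
    "\<And>t p. t \<in> {0..1} \<Longrightarrow> p \<in> topspace X \<Longrightarrow>
      min (f p) (g p) \<le> h (t, p) \<and> h (t, p) \<le> max (f p) (g p)"
proof -
  have sublevel: "\<exists>b. \<forall>p\<in>topspace X. v p < pt a \<longrightarrow> u p < pt b"
    if u: "continuous_map X euclidean u" and v: "continuous_map X euclidean v"
      and uv: "\<And>e J. e \<in> E \<Longrightarrow>
        unbounded_on_face K (\<lambda>x. u (e x)) J \<longleftrightarrow> unbounded_on_face K (\<lambda>x. v (e x)) J"
    for u v :: "'a \<Rightarrow> long_ray" and a
  proof -
    have "\<exists>b. \<forall>x\<in>PiE K (\<lambda>_. UNIV). v (e x) < pt a \<longrightarrow> u (e x) < pt b" if E: "e \<in> E" for e
      using uv[OF E] \<open>finite K\<close> continuous_map_compose[OF e[OF E] u]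
        continuous_map_compose[OF e[OF E] v]
      by (intro bounded_on_sublevel continuous_map_imp_seq_cont) (simp_all add: o_def)
    then obtain b where b: "\<And>e x. e \<in> E \<Longrightarrow> x \<in> PiE K (\<lambda>_. UNIV) \<Longrightarrow> v (e x) < pt a \<Longrightarrow> u (e x) < pt (b e)"
      by metis
    obtain b' where b': "\<And>e. e \<in> E \<Longrightarrow> b e < b'"
      using omega1_countable_bounded[of "b ` E"] \<open>finite E\<close> by (auto simp: countable_finite)
    have "u p < pt b'" if p: "p \<in> topspace X" and "v p < pt a" for p
    proof -
      obtain e x where ex: "e \<in> E" "x \<in> PiE K (\<lambda>_. UNIV)" "p = e x" using cover p by blast
      then have "u p < pt (b e)" using b that by simp
      also have "\<dots> < pt b'" using b'[OF ex(1)] by simp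
      finally show ?thesis .
    qed
    then show ?thesis by blast
  qed
  show thesis
    by (rule coarse_homotopy[OF f g sublevel[OF f g same] sublevel[OF g f same[symmetric]] that])
qed

lemma homotopic_withI_topspace:
  assumes "continuous_map (prod_topology (top_of_set {0..1::real}) X) Y h"
    "\<And>p. p \<in> topspace X \<Longrightarrow> h (0, p) = f p" "\<And>p. p \<in> topspace X \<Longrightarrow> h (1, p) = g p"
  shows "homotopic_with (\<lambda>_. True) X Y f g"
  using assms by (subst homotopic_with) auto

section \<open>Positive and negative parts in the long line\<close>

lift_definition pos_part :: "long_line \<Rightarrow> long_ray" is "case_sum (\<lambda>x. x) (\<lambda>_. 0)" by auto
lift_definition neg_part :: "long_line \<Rightarrow> long_ray" is "case_sum (\<lambda>_. 0) (\<lambda>x. x)" by auto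

lemma parts_ray [simp]:
  "pos_part (pos_ray x) = x" "pos_part (neg_ray x) = 0"
  "neg_part (pos_ray x) = 0" "neg_part (neg_ray x) = x"
  unfolding pos_ray_def neg_ray_def by (transfer, simp)+

lemma neg_ray_0: "neg_ray 0 = pos_ray 0"
  unfolding pos_ray_def neg_ray_def by transfer simp

lemma long_line_cases: obtains x where "y = pos_ray x" | x where "y = neg_ray x"
proof -
  have "(\<exists>x. y = pos_ray x) \<or> (\<exists>x. y = neg_ray x)"
    unfolding pos_ray_def neg_ray_def
    by (induction y rule: long_line.abs_induct) (metis sum.exhaust)
  then show thesis using that by blast
qed

lemma continuous_pos_ray: "continuous_on UNIV pos_ray" and continuous_neg_ray: "continuous_on UNIV neg_ray"
  by (auto simp: continuous_on_open_vimage open_long_line_def)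

text \<open>Pulled back along \<open>neg_ray\<close>, the preimage of \<open>U\<close> is everything
  or empty, according to whether \<open>0 \<in> U\<close>.\<close>

lemma continuous_pos_part: "continuous_on UNIV pos_part"
proof -
  have "open (pos_part -` U)" if "open U" for U
    using that unfolding open_long_line_def vimage_comp[symmetric]
    by (cases "0 \<in> U") (auto simp: vimage_def)
  then show ?thesis by (simp add: continuous_on_open_vimage)
qed

lemma continuous_neg_part: "continuous_on UNIV neg_part"
proof -
  have "open (neg_part -` U)" if "open U" for U
    using that unfolding open_long_line_def vimage_comp[symmetric]
    by (cases "0 \<in> U") (auto simp: vimage_def)
  then show ?thesis by (simp add: continuous_on_open_vimage)
qed

text \<open>Identifies the union of the two axes in the square of the long ray with the long line,
  inverse to taking both parts. Off the axes the value has no meaning.\<close>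

definition wedge :: "long_ray \<Rightarrow> long_ray \<Rightarrow> long_line" where
  "wedge x y = (if y = 0 then pos_ray x else neg_ray y)"

lemma wedge_simps [simp]: "wedge x 0 = pos_ray x" "wedge 0 y = neg_ray y"
  by (simp_all add: wedge_def neg_ray_0)

lemma wedge_parts: "wedge (pos_part y) (neg_part y) = y"
  by (cases y rule: long_line_cases) simp_all

lemma pos_part_0_or_neg_part_0: "pos_part y = 0 \<or> neg_part y = 0"
  by (cases y rule: long_line_cases) simp_all

text \<open>The two axes are closed and the formulas agree at the origin, so pasting makes
  \<open>wedge\<close> continuous on their union.\<close>

lemma continuous_map_wedge:
  assumes a: "continuous_map X euclidean a" and b: "continuous_map X euclidean b"
    and ab: "\<And>x. x \<in> topspace X \<Longrightarrow> a x = 0 \<or> b x = 0"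
  shows "continuous_map X euclidean (\<lambda>x. wedge (a x) (b x))"
  unfolding continuous_map_iff_tendsto
proof
  fix x assume x: "x \<in> topspace X"
  let ?D = "UNIV \<times> {0 :: long_ray} \<union> {0 :: long_ray} \<times> UNIV"
  have "continuous_on ?D (\<lambda>z. if snd z = 0 then pos_ray (fst z) else neg_ray (snd z))"
    by (intro continuous_on_cases closed_Times closed_UNIV closed_singleton
        continuous_on_compose2[OF continuous_pos_ray] continuous_on_compose2[OF continuous_neg_ray])
      (auto simp: neg_ray_0 intro: continuous_intros)
  then have D: "continuous_on ?D (\<lambda>z. wedge (fst z) (snd z))" by (simp add: wedge_def)
  have lim: "((\<lambda>x. (a x, b x)) \<longlongrightarrow> (a x, b x)) (nhdsin X x)"
    using a b x by (auto simp: continuous_map_iff_tendsto intro: tendsto_Pair)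
  have ev: "\<forall>\<^sub>F x in nhdsin X x. (a x, b x) \<in> ?D"
    using ab x unfolding eventually_nhdsin by (intro disjI2 exI[of _ "topspace X"]) auto
  have "(a x, b x) \<in> ?D" using ab[OF x] by auto
  from continuous_on_tendsto_compose[OF D lim this ev]
  show "((\<lambda>x. wedge (a x) (b x)) \<longlongrightarrow> wedge (a x) (b x)) (nhdsin X x)"
    by simp
qed

section \<open>Maps from powers of the long line to the long ray\<close>

definition orthant :: "nat \<Rightarrow> nat set \<Rightarrow> (nat \<Rightarrow> long_ray) \<Rightarrow> nat \<Rightarrow> long_line" where
  "orthant n S x = restrict (\<lambda>i. if i \<in> S then pos_ray (x i) else neg_ray (x i)) {1..n}"

definition signed_face_point :: "nat \<Rightarrow> int set \<Rightarrow> omega1 \<Rightarrow> nat \<Rightarrow> long_line" where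
  "signed_face_point n I c = restrict (\<lambda>i. if int i \<in> I then pos_ray (pt c)
     else if - int i \<in> I then neg_ray (pt c) else pos_ray 0) {1..n}"

text \<open>The complete homotopy invariant of a map into the long ray: an upward closed family in
  the poset of admissible sets.\<close>

definition unbounded_faces :: "nat \<Rightarrow> ((nat \<Rightarrow> long_line) \<Rightarrow> long_ray) \<Rightarrow> int set set" where
  "unbounded_faces n f = {I. admissible n I \<and> \<not> (\<exists>b. \<forall>c. f (signed_face_point n I c) \<le> pt b)}"

lemma continuous_map_orthant: "continuous_map (long_ray_power n) (long_line_power n) (orthant n S)"
proof -
  have "continuous_map (long_ray_power n) euclidean (\<lambda>x. orthant n S x i)" if "i \<in> {1..n}" for i
  proof -
    have "continuous_map (long_ray_power n) euclidean (\<lambda>x. x i)"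
      unfolding power_top_def using that by (rule continuous_map_product_projection)
    moreover have "continuous_map euclidean euclidean (if i \<in> S then pos_ray else neg_ray)"
      using continuous_pos_ray continuous_neg_ray by auto
    ultimately have "continuous_map (long_ray_power n) euclidean ((if i \<in> S then pos_ray else neg_ray) \<circ> (\<lambda>x. x i))"
      by (rule continuous_map_compose)
    then show ?thesis using that by (cases "i \<in> S") (simp_all add: orthant_def o_def)
  qed
  then show ?thesis
    unfolding power_top_def by (auto simp: continuous_map_componentwise orthant_def)
qed

lemma orthants_cover:
  assumes "p \<in> topspace (long_line_power n)"
  shows "p \<in> (\<Union>e\<in>orthant n ` Pow {1..n}. e ` PiE {1..n} (\<lambda>_. UNIV))"
proof -
  define S where "S = {i\<in>{1..n}. p i \<in> range pos_ray}"
  define x where "x = restrict (\<lambda>i. if i \<in> S then pos_part (p i) else neg_part (p i)) {1..n}"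
  have "p i = (if i \<in> S then pos_ray (x i) else neg_ray (x i))" if "i \<in> {1..n}" for i
  proof (cases "p i \<in> range pos_ray")
    case True
    then show ?thesis using that by (auto simp: S_def x_def)
  next
    case False
    then obtain y where "p i = neg_ray y" using long_line_cases by blast
    then show ?thesis using that False by (simp add: S_def x_def)
  qed
  moreover have "p \<in> extensional {1..n}" using assms by (simp add: power_top_def PiE_def)
  ultimately have "p = orthant n S x"
    by (intro extensionalityI[of p "{1..n}"]) (auto simp: orthant_def)
  moreover have "x \<in> PiE {1..n} (\<lambda>_. UNIV)" by (simp add: x_def)
  moreover have "S \<in> Pow {1..n}" by (auto simp: S_def)
  ultimately show ?thesis by blast
qed

text \<open>Coordinates not mentioned in \<open>I\<close> sit at the common origin of the two rays,
  so any \<open>S\<close> compatible with the signs in \<open>I\<close> works. This freedom allows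
  two nested signed sets to be viewed in one orthant.\<close>

lemma signed_face_point_eq_orthant:
  assumes "\<And>i. i \<in> {1..n} \<Longrightarrow> int i \<in> I \<Longrightarrow> i \<in> S" "\<And>i. i \<in> {1..n} \<Longrightarrow> - int i \<in> I \<Longrightarrow> i \<notin> S"
  shows "signed_face_point n I c =
    orthant n S (face_point {1..n} {i. int i \<in> I \<or> - int i \<in> I} c (\<lambda>_. 0))"
  unfolding signed_face_point_def orthant_def
  by (rule restrict_ext) (use assms in \<open>auto simp: face_point_def neg_ray_0\<close>)

lemma orthant_face_point:
  fixes S :: "nat set"
  assumes "J \<subseteq> {1..n}"
  defines "I \<equiv> int ` (J \<inter> S) \<union> (\<lambda>i. - int i) ` (J - S)"
  shows "admissible n I" "orthant n S (face_point {1..n} J c (\<lambda>_. 0)) = signed_face_point n I c"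
proof -
  have pos: "int i \<in> I \<longleftrightarrow> i \<in> J \<inter> S" and neg: "- int i \<in> I \<longleftrightarrow> i \<in> J - S" if "i \<in> {1..n}" for i
    using that assms(1) unfolding I_def by (force, force)
  show "admissible n I"
    unfolding admissible_def using pos neg assms(1) by (auto simp: I_def signed_coords_def)
  show "orthant n S (face_point {1..n} J c (\<lambda>_. 0)) = signed_face_point n I c"
    unfolding signed_face_point_def orthant_def
    by (rule restrict_ext) (use pos neg in \<open>auto simp: face_point_def neg_ray_0\<close>)
qed

lemma unbounded_faces_iff:
  assumes "admissible n I"
  shows "I \<in> unbounded_faces n f \<longleftrightarrow>
    unbounded_on_face {1..n} (\<lambda>x. f (orthant n {i. int i \<in> I} x)) {i. int i \<in> I \<or> - int i \<in> I}"
proof -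
  have "signed_face_point n I c =
    orthant n {i. int i \<in> I} (face_point {1..n} {i. int i \<in> I \<or> - int i \<in> I} c (\<lambda>_. 0))" for c
    by (rule signed_face_point_eq_orthant) (use assms in \<open>auto simp: admissible_def\<close>)
  then show ?thesis using assms by (simp add: unbounded_faces_def unbounded_on_face_def)
qed

lemma homotopic_imp_unbounded_faces_eq:
  assumes "homotopic_with (\<lambda>_. True) (long_line_power n) euclidean f g"
  shows "unbounded_faces n f = unbounded_faces n g"
proof -
  have "I \<in> unbounded_faces n f \<longleftrightarrow> I \<in> unbounded_faces n g" if "admissible n I" for I
    unfolding unbounded_faces_iff[OF that]
    by (rule homotopic_imp_same_faces[OF assms]) (use continuous_map_orthant in \<open>auto simp: power_top_def\<close>)
  then show ?thesis by (auto simp: unbounded_faces_def)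
qed

lemma unbounded_faces_eq_imp_homotopic:
  assumes f: "continuous_map (long_line_power n) euclidean f"
    and g: "continuous_map (long_line_power n) euclidean g"
    and fg: "unbounded_faces n f = unbounded_faces n g"
  shows "homotopic_with (\<lambda>_. True) (long_line_power n) euclidean f g"
proof (rule homotopy_of_same_faces[OF f g])
  show "finite (orthant n ` Pow {1..n})" "finite {1..n}" by simp_all
  show "topspace (long_line_power n) \<subseteq> (\<Union>e\<in>orthant n ` Pow {1..n}. e ` PiE {1..n} (\<lambda>_. UNIV))"
    using orthants_cover by blast
  fix e assume "e \<in> orthant n ` Pow {1..n}"
  then obtain S where e: "e = orthant n S" by blast
  show "continuous_map (product_topology (\<lambda>_. euclidean) {1..n}) (long_line_power n) e"
    using continuous_map_orthant by (simp add: e power_top_def)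
  fix J
  have "unbounded_on_face {1..n} h J \<longleftrightarrow> unbounded_on_face {1..n} h (J \<inter> {1..n})" for h
  proof -
    have "face_point {1..n} J c r = face_point {1..n} (J \<inter> {1..n}) c r" for c and r :: "nat \<Rightarrow> long_ray"
      unfolding face_point_def by (rule restrict_ext) simp
    then show ?thesis by (simp add: unbounded_on_face_def)
  qed
  moreover have "unbounded_on_face {1..n} (\<lambda>x. h (e x)) (J \<inter> {1..n}) \<longleftrightarrow>
      int ` (J \<inter> {1..n} \<inter> S) \<union> (\<lambda>i. - int i) ` (J \<inter> {1..n} - S) \<in> unbounded_faces n h" for h
    using orthant_face_point[of "J \<inter> {1..n}" n S]
    by (simp add: unbounded_on_face_def unbounded_faces_def e)
  ultimately show "unbounded_on_face {1..n} (\<lambda>x. f (e x)) J \<longleftrightarrow> unbounded_on_face {1..n} (\<lambda>x. g (e x)) J"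
    using fg by metis
qed (rule homotopic_withI_topspace)

text \<open>Both signed sets lie in the orthant given by the signs of \<open>I'\<close>, where
  \<open>unbounded_on_face_mono\<close> applies.\<close>

lemma unbounded_faces_upward_closed:
  assumes f: "continuous_map (long_line_power n) euclidean f"
    and I: "I \<in> unbounded_faces n f" and "I \<subseteq> I'" and I': "admissible n I'"
  shows "I' \<in> unbounded_faces n f"
proof -
  let ?S = "{i. int i \<in> I'}"
  have "signed_face_point n I c =
    orthant n ?S (face_point {1..n} {i. int i \<in> I \<or> - int i \<in> I} c (\<lambda>_. 0))" for c
    by (rule signed_face_point_eq_orthant) (use I' \<open>I \<subseteq> I'\<close> in \<open>auto simp: admissible_def\<close>)
  then have unb: "unbounded_on_face {1..n} (\<lambda>x. f (orthant n ?S x)) {i. int i \<in> I \<or> - int i \<in> I}"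
    using I by (simp add: unbounded_faces_def unbounded_on_face_def)
  have sc: "seq_cont {1..n} (\<lambda>x. f (orthant n ?S x))"
    using continuous_map_compose[OF continuous_map_orthant f]
    by (intro continuous_map_imp_seq_cont) (simp add: power_top_def o_def)
  show ?thesis
    unfolding unbounded_faces_iff[OF I']
    by (rule unbounded_on_face_mono[OF sc _ unb]) (use \<open>I \<subseteq> I'\<close> in auto)
qed

text \<open>The face point of the empty set is the origin for every \<open>c\<close>; this is why
  the empty set is removed from the poset.\<close>

lemma empty_notin_unbounded_faces: "{} \<notin> unbounded_faces n f"
proof -
  obtain b where "f (restrict (\<lambda>_. pos_ray 0) {1..n}) < pt b" using exists_pt_gt by blast
  then have "\<forall>c. f (signed_face_point n {} c) \<le> pt b"
    by (simp add: signed_face_point_def less_imp_le)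
  then show ?thesis unfolding unbounded_faces_def by blast
qed

section \<open>Max-min maps realising the antichains\<close>

definition signed_coordinate :: "int \<Rightarrow> (nat \<Rightarrow> long_line) \<Rightarrow> long_ray" where
  "signed_coordinate i p = (if 0 < i then pos_part (p (nat i)) else neg_part (p (nat (- i))))"

text \<open>The minimum over \<open>J\<close> is unbounded on the diagonal of \<open>I\<close>
  exactly if \<open>J \<subseteq> I\<close>, and the maximum turns this into membership in the
  family generated by \<open>A\<close>. The inserted \<open>0\<close> makes the empty antichain give
  the constant map.\<close>

definition max_min_map :: "int set set \<Rightarrow> (nat \<Rightarrow> long_line) \<Rightarrow> long_ray" where
  "max_min_map A p = Max (insert 0 ((\<lambda>I. Min ((\<lambda>i. signed_coordinate i p) ` I)) ` A))"

lemma finite_signed_coords: "finite (signed_coords n)"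
  by (simp add: signed_coords_def)

lemma finite_admissible_sets: "finite (admissible_sets n)"
  by (rule finite_subset[of _ "Pow (signed_coords n)"])
    (auto simp: admissible_sets_def admissible_def finite_signed_coords)

lemma continuous_map_Min:
  fixes F :: "'i \<Rightarrow> 'a \<Rightarrow> 'b::linorder_topology"
  assumes "finite A" "A \<noteq> {}" "\<And>i. i \<in> A \<Longrightarrow> continuous_map X euclidean (F i)"
  shows "continuous_map X euclidean (\<lambda>p. Min ((\<lambda>i. F i p) ` A))"
  using assms
proof (induction A rule: finite_ne_induct)
  case (insert i A)
  then have "continuous_map X euclidean (F i)"
    "continuous_map X euclidean (\<lambda>p. Min ((\<lambda>i. F i p) ` A))" by simp_all
  then have "continuous_map X euclidean (\<lambda>p. min (F i p) (Min ((\<lambda>i. F i p) ` A)))"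
    unfolding continuous_map_iff_tendsto by (auto intro!: tendsto_min)
  then show ?case using insert.hyps by simp
qed simp

lemma continuous_map_Max:
  fixes F :: "'i \<Rightarrow> 'a \<Rightarrow> 'b::linorder_topology"
  assumes "finite A" "A \<noteq> {}" "\<And>i. i \<in> A \<Longrightarrow> continuous_map X euclidean (F i)"
  shows "continuous_map X euclidean (\<lambda>p. Max ((\<lambda>i. F i p) ` A))"
  using assms
proof (induction A rule: finite_ne_induct)
  case (insert i A)
  then have "continuous_map X euclidean (F i)"
    "continuous_map X euclidean (\<lambda>p. Max ((\<lambda>i. F i p) ` A))" by simp_all
  then have "continuous_map X euclidean (\<lambda>p. max (F i p) (Max ((\<lambda>i. F i p) ` A)))"
    unfolding continuous_map_iff_tendsto by (auto intro!: tendsto_max)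
  then show ?case using insert.hyps by simp
qed simp

lemma continuous_map_signed_coordinate:
  assumes "i \<in> signed_coords n"
  shows "continuous_map (long_line_power n) euclidean (signed_coordinate i)"
proof -
  have proj: "continuous_map (long_line_power n) euclidean (\<lambda>p. p k)" if "k \<in> {1..n}" for k
    unfolding power_top_def using that by (rule continuous_map_product_projection)
  have parts: "continuous_map euclidean euclidean pos_part" "continuous_map euclidean euclidean neg_part"
    using continuous_pos_part continuous_neg_part by simp_all
  consider k where "k \<in> {1..n}" "i = int k" | k where "k \<in> {1..n}" "i = - int k"
    using assms by (auto simp: signed_coords_def)
  then show ?thesis
  proof cases
    case 1
    then have "signed_coordinate i = pos_part \<circ> (\<lambda>p. p k)"
      by (auto simp: signed_coordinate_def fun_eq_iff)
    then show ?thesis using continuous_map_compose[OF proj[OF 1(1)] parts(1)] by simp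
  next
    case 2
    then have "signed_coordinate i = neg_part \<circ> (\<lambda>p. p k)"
      by (auto simp: signed_coordinate_def fun_eq_iff)
    then show ?thesis using continuous_map_compose[OF proj[OF 2(1)] parts(2)] by simp
  qed
qed

lemma signed_coordinate_face_point:
  assumes I: "admissible n I" and i: "i \<in> signed_coords n"
  shows "signed_coordinate i (signed_face_point n I c) = (if i \<in> I then pt c else 0)"
proof -
  consider k where "k \<in> {1..n}" "i = int k" | k where "k \<in> {1..n}" "i = - int k"
    using i by (auto simp: signed_coords_def)
  then show ?thesis
    using I by cases (auto simp: signed_coordinate_def signed_face_point_def admissible_def)
qed

context
  fixes n :: nat and A :: "int set set"
  assumes A: "A \<subseteq> admissible_sets n - {{}}"
begin

lemma admissible_memD:
  assumes "J \<in> A"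
  shows "admissible n J" "finite J" "J \<noteq> {}" "J \<subseteq> signed_coords n"
  using assms A finite_subset[OF _ finite_signed_coords[of n]]
  by (auto simp: admissible_sets_def admissible_def)

lemma finite_admissible_family: "finite A"
  using A finite_admissible_sets[of n] finite_subset by blast

lemma continuous_map_max_min_map: "continuous_map (long_line_power n) euclidean (max_min_map A)"
proof -
  \<comment> \<open>The index \<open>None\<close> stands for the inserted constant \<open>0\<close>,
    so the index set is nonempty even if \<open>A\<close> is empty.\<close>
  define F where "F J p = (case J of None \<Rightarrow> 0 | Some J \<Rightarrow> Min ((\<lambda>i. signed_coordinate i p) ` J))"
    for J and p :: "nat \<Rightarrow> long_line"
  have "continuous_map (long_line_power n) euclidean
      (\<lambda>p. Max ((\<lambda>J. F J p) ` insert None (Some ` A)))"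
  proof (rule continuous_map_Max)
    fix J assume "J \<in> insert None (Some ` A)"
    then consider "J = None" | I where "I \<in> A" "J = Some I" by blast
    then show "continuous_map (long_line_power n) euclidean (F J)"
    proof cases
      case 2
      have "continuous_map (long_line_power n) euclidean (signed_coordinate i)" if "i \<in> I" for i
        using continuous_map_signed_coordinate admissible_memD(4)[OF 2(1)] that by blast
      then show ?thesis
        unfolding F_def 2(2) option.case
        using admissible_memD(2,3)[OF 2(1)] by (intro continuous_map_Min)
    qed (simp add: F_def[abs_def])
  qed (use finite_admissible_family in auto)
  moreover have "(\<lambda>J. F J p) ` insert None (Some ` A) =
      insert 0 ((\<lambda>I. Min ((\<lambda>i. signed_coordinate i p) ` I)) ` A)" for p
    by (simp add: F_def image_image)
  ultimately show ?thesis by (simp add: max_min_map_def[abs_def])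
qed

text \<open>At a face point every signed coordinate is \<open>pt c\<close> or \<open>0\<close>, so
  each inner minimum reduces to the test \<open>J \<subseteq> I\<close>.\<close>

lemma max_min_map_face_point:
  assumes I: "admissible n I"
  shows "max_min_map A (signed_face_point n I c) = (if \<exists>J\<in>A. J \<subseteq> I then pt c else 0)"
proof -
  have Min: "Min ((\<lambda>i. signed_coordinate i (signed_face_point n I c)) ` J) = (if J \<subseteq> I then pt c else 0)"
    if J: "J \<in> A" for J
  proof -
    have im: "(\<lambda>i. signed_coordinate i (signed_face_point n I c)) ` J = (\<lambda>i. if i \<in> I then pt c else 0) ` J"
      using admissible_memD(4)[OF J] signed_coordinate_face_point[OF I] by (intro image_cong) auto
    show ?thesis
    proof (cases "J \<subseteq> I")
      case True
      then have "(\<lambda>i. if i \<in> I then pt c else 0) ` J = {pt c}" using admissible_memD(3)[OF J] by auto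
      then show ?thesis using True im by simp
    next
      case False
      then have "0 \<in> (\<lambda>i. if i \<in> I then pt c else 0) ` J" by auto
      then show ?thesis using False im admissible_memD(2)[OF J] long_ray_zero_le
        by (intro antisym) (auto intro: Min_le)
    qed
  qed
  then have im: "(\<lambda>J. Min ((\<lambda>i. signed_coordinate i (signed_face_point n I c)) ` J)) ` A =
      (\<lambda>J. if J \<subseteq> I then pt c else 0) ` A"
    by (intro image_cong) auto
  show ?thesis
    unfolding max_min_map_def im
    using finite_admissible_family long_ray_zero_le
    by (auto intro!: Max_eqI)
qed

lemma unbounded_faces_max_min_map:
  "unbounded_faces n (max_min_map A) = {I. admissible n I \<and> (\<exists>J\<in>A. J \<subseteq> I)}"
proof -
  have "(\<exists>b. \<forall>c. max_min_map A (signed_face_point n I c) \<le> pt b) \<longleftrightarrow> \<not> (\<exists>J\<in>A. J \<subseteq> I)"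
    if "admissible n I" for I
  proof (cases "\<exists>J\<in>A. J \<subseteq> I")
    case True
    have "\<not> (\<forall>c. pt c \<le> pt b)" for b using exists_gt_omega1 by (auto simp: not_le)
    then show ?thesis using True max_min_map_face_point[OF that] by simp
  next
    case False
    then show ?thesis using max_min_map_face_point[OF that] long_ray_zero_le by auto
  qed
  then show ?thesis unfolding unbounded_faces_def by blast
qed

end

text \<open>An antichain consists of the minimal elements of the family it generates: passing from
  \<open>I\<close> down to \<open>B\<close> and back down to \<open>A\<close> must return to
  \<open>I\<close>, so all sets on the way coincide.\<close>

lemma antichain_eqI:
  assumes "antichain A" "antichain B"
    and "\<And>I. I \<in> A \<Longrightarrow> \<exists>J\<in>B. J \<subseteq> I" "\<And>I. I \<in> B \<Longrightarrow> \<exists>J\<in>A. J \<subseteq> I"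
  shows "A = B"
proof -
  have "A \<subseteq> B" if A: "antichain A" and AB: "\<And>I. I \<in> A \<Longrightarrow> \<exists>J\<in>B. J \<subseteq> I" "\<And>I. I \<in> B \<Longrightarrow> \<exists>J\<in>A. J \<subseteq> I"
    for A B :: "'a set set"
  proof
    fix I assume "I \<in> A"
    then obtain J J' where "J \<in> B" "J \<subseteq> I" "J' \<in> A" "J' \<subseteq> J" using AB by metis
    then have "J' = I" using A \<open>I \<in> A\<close> unfolding antichain_def by blast
    then show "I \<in> B" using \<open>J \<in> B\<close> \<open>J \<subseteq> I\<close> \<open>J' \<subseteq> J\<close> by auto
  qed
  then show ?thesis using assms by blast
qed

text \<open>The bijection is constructed from antichains to classes by \<open>max_min_map\<close>
  and then inverted. Injectivity recovers the antichain from the invariant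
  \<open>unbounded_faces\<close>; surjectivity uses that the invariant is complete.\<close>

lemma homotopy_classes_long_line_power_long_ray:
  "\<exists>\<phi>. bij_betw \<phi>
     (homotopy_classes (long_line_power n) (euclidean :: long_ray topology))
     {A. A \<subseteq> admissible_sets n - {{}} \<and> antichain A}"
proof -
  let ?X = "long_line_power n" and ?Y = "euclidean :: long_ray topology"
  let ?AC = "{A. A \<subseteq> admissible_sets n - {{}} \<and> antichain A}"
  define \<psi> where "\<psi> A = homotopy_rel ?X ?Y `` {max_min_map A}" for A
  have "bij_betw \<psi> ?AC (homotopy_classes ?X ?Y)"
  proof (rule bij_betw_imageI)
    show "inj_on \<psi> ?AC"
    proof (rule inj_onI)
      fix A B assume A: "A \<in> ?AC" and B: "B \<in> ?AC" and "\<psi> A = \<psi> B"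
      then have "(max_min_map A, max_min_map B) \<in> homotopy_rel ?X ?Y"
        unfolding \<psi>_def
        by (subst (asm) eq_equiv_class_iff[OF equiv_homotopy_rel]) (auto intro: continuous_map_max_min_map)
      then have "unbounded_faces n (max_min_map A) = unbounded_faces n (max_min_map B)"
        by (intro homotopic_imp_unbounded_faces_eq) (simp add: homotopy_rel_def)
      then have "{I. admissible n I \<and> (\<exists>J\<in>A. J \<subseteq> I)} = {I. admissible n I \<and> (\<exists>J\<in>B. J \<subseteq> I)}"
        using A B by (simp add: unbounded_faces_max_min_map)
      moreover have "admissible n I" if "I \<in> A \<union> B" for I
        using that A B by (auto simp: admissible_sets_def)
      ultimately show "A = B"
        using A B by (intro antichain_eqI) blast+
    qed
    show "\<psi> ` ?AC = homotopy_classes ?X ?Y"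
    proof
      show "\<psi> ` ?AC \<subseteq> homotopy_classes ?X ?Y"
        by (auto simp: \<psi>_def homotopy_classes_def intro!: quotientI continuous_map_max_min_map)
      show "homotopy_classes ?X ?Y \<subseteq> \<psi> ` ?AC"
      proof
        fix c assume "c \<in> homotopy_classes ?X ?Y"
        then obtain f where f: "continuous_map ?X ?Y f" and c: "c = homotopy_rel ?X ?Y `` {f}"
          by (auto simp: homotopy_classes_def elim: quotientE)
        let ?U = "unbounded_faces n f"
        \<comment> \<open>The minimal unbounded faces. By finiteness each unbounded face contains
          one of them, so upward closure makes them generate the whole family.\<close>
        define A where "A = {I\<in>?U. \<forall>J\<in>?U. J \<subseteq> I \<longrightarrow> J = I}"
        have U: "?U \<subseteq> admissible_sets n - {{}}"
          using empty_notin_unbounded_faces[of n f] unfolding unbounded_faces_def admissible_sets_def by blast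
        then have A: "A \<subseteq> admissible_sets n - {{}}" by (auto simp: A_def)
        moreover have "antichain A" by (auto simp: A_def antichain_def)
        moreover have "unbounded_faces n (max_min_map A) = ?U"
        proof -
          have "finite ?U" using U finite_admissible_sets[of n] finite_subset by blast
          then have "\<exists>J\<in>A. J \<subseteq> I" if "I \<in> ?U" for I
            using finite_has_minimal2[OF _ that] unfolding A_def by blast
          then show ?thesis
            unfolding unbounded_faces_max_min_map[OF A]
            using unbounded_faces_upward_closed[OF f] by (auto simp: A_def unbounded_faces_def)
        qed
        then have "homotopic_with (\<lambda>_. True) ?X ?Y (max_min_map A) f"
          using f A by (intro unbounded_faces_eq_imp_homotopic continuous_map_max_min_map)
        then have "\<psi> A = c"
          unfolding \<psi>_def c by (intro equiv_class_eq[OF equiv_homotopy_rel]) (simp add: homotopy_rel_def)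
        ultimately show "c \<in> \<psi> ` ?AC" by blast
      qed
    qed
  qed
  then show ?thesis using bij_betw_inv by blast
qed

section \<open>Maps from powers of the long ray to the long line\<close>

lemma bounded_iff_not_unbounded_on_face:
  fixes f :: "(nat \<Rightarrow> long_ray) \<Rightarrow> long_ray"
  assumes f: "continuous_map (long_ray_power n) euclidean f"
  shows "(\<exists>z. \<forall>p\<in>topspace (long_ray_power n). f p \<le> z) \<longleftrightarrow> \<not> unbounded_on_face {1..n} f {1..n}"
proof
  have top: "face_point {1..n} J c r \<in> topspace (long_ray_power n)" for J c r
    by (simp add: face_point_def power_top_def)
  assume "\<exists>z. \<forall>p\<in>topspace (long_ray_power n). f p \<le> z"
  then obtain z where z: "\<And>p. p \<in> topspace (long_ray_power n) \<Longrightarrow> f p \<le> z" by blast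
  obtain b where "z < pt b" using exists_pt_gt by blast
  then have "\<forall>c. f (face_point {1..n} {1..n} c (\<lambda>_. 0)) \<le> pt b"
    using z[OF top] by (meson less_imp_le order_trans)
  then show "\<not> unbounded_on_face {1..n} f {1..n}" unfolding unbounded_on_face_def by blast
next
  assume nu: "\<not> unbounded_on_face {1..n} f {1..n}"
  have f': "seq_cont {1..n} f" using f by (intro continuous_map_imp_seq_cont) (simp add: power_top_def)
  \<comment> \<open>Comparison with the constant map \<open>0\<close>. A bounded full diagonal
    excludes every unbounded face by monotonicity, so the comparison of faces is vacuous, while the
    sublevel set of \<open>0\<close> is the whole space.\<close>
  have "\<exists>b. \<forall>p\<in>PiE {1..n} (\<lambda>_. UNIV). (0::long_ray) < pt a \<longrightarrow> f p < pt b" for a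
    by (rule bounded_on_sublevel[OF f'])
      (use nu unbounded_on_face_mono[OF f'] in \<open>auto simp: seq_cont_def\<close>)
  moreover obtain a where "0 < pt a" using exists_pt_gt by blast
  ultimately obtain b where "\<forall>p\<in>PiE {1..n} (\<lambda>_. UNIV). f p < pt b" by blast
  then have "\<forall>p\<in>topspace (long_ray_power n). f p \<le> pt b"
    by (simp add: power_top_def less_imp_le)
  then show "\<exists>z. \<forall>p\<in>topspace (long_ray_power n). f p \<le> z" by blast
qed

text \<open>The homotopy stays between \<open>f p\<close> and \<open>0\<close>, hence is constant
  where \<open>f\<close> vanishes. This last property lets one half of the long line be contracted
  while the other is left alone.\<close>

lemma bounded_homotopy_to_zero:
  fixes f :: "(nat \<Rightarrow> long_ray) \<Rightarrow> long_ray"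
  assumes f: "continuous_map (long_ray_power n) euclidean f"
    and b: "\<forall>p\<in>topspace (long_ray_power n). f p \<le> z"
  obtains h where
    "continuous_map (prod_topology (top_of_set {0..1::real}) (long_ray_power n)) euclidean h"
    "\<And>p. p \<in> topspace (long_ray_power n) \<Longrightarrow> h (0, p) = f p"
    "\<And>p. p \<in> topspace (long_ray_power n) \<Longrightarrow> h (1, p) = 0"
    "\<And>t p. t \<in> {0..1} \<Longrightarrow> p \<in> topspace (long_ray_power n) \<Longrightarrow> f p = 0 \<Longrightarrow> h (t, p) = 0"
proof (rule coarse_homotopy[OF f, of "\<lambda>_. 0"])
  obtain b' where "z < pt b'" using exists_pt_gt by blast
  then show "\<exists>b. \<forall>p\<in>topspace (long_ray_power n). 0 < pt a \<longrightarrow> f p < pt b" for a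
    using b by (meson le_less_trans)
  show "\<exists>b. \<forall>p\<in>topspace (long_ray_power n). f p < pt a \<longrightarrow> 0 < pt b" for a
    using exists_pt_gt by blast
  fix h
  assume h: "continuous_map (prod_topology (top_of_set {0..1::real}) (long_ray_power n)) euclidean h"
    "\<And>p. p \<in> topspace (long_ray_power n) \<Longrightarrow> h (0, p) = f p"
    "\<And>p. p \<in> topspace (long_ray_power n) \<Longrightarrow> h (1, p) = 0"
    "\<And>t p. t \<in> {0..1} \<Longrightarrow> p \<in> topspace (long_ray_power n) \<Longrightarrow>
      min (f p) 0 \<le> h (t, p) \<and> h (t, p) \<le> max (f p) 0"
  have "h (t, p) = 0" if "t \<in> {0..1}" "p \<in> topspace (long_ray_power n)" "f p = 0" for t p
    using h(4)[OF that(1,2)] that(3) by (simp add: antisym)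
  then show thesis using that h by blast
qed simp_all

lemma homotopic_zero_iff_bounded:
  fixes f :: "(nat \<Rightarrow> long_ray) \<Rightarrow> long_ray"
  assumes f: "continuous_map (long_ray_power n) euclidean f"
  shows "homotopic_with (\<lambda>_. True) (long_ray_power n) euclidean f (\<lambda>_. 0) \<longleftrightarrow>
    (\<exists>z. \<forall>p\<in>topspace (long_ray_power n). f p \<le> z)"
proof
  assume "homotopic_with (\<lambda>_. True) (long_ray_power n) euclidean f (\<lambda>_. 0)"
  from homotopic_imp_same_faces[OF this, of "{1..n}" "\<lambda>x. x" "{1..n}"]
  have "unbounded_on_face {1..n} f {1..n} \<longleftrightarrow> unbounded_on_face {1..n} (\<lambda>_. 0) {1..n}"
    by (simp add: power_top_def)
  then show "\<exists>z. \<forall>p\<in>topspace (long_ray_power n). f p \<le> z"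
    unfolding bounded_iff_not_unbounded_on_face[OF f]
    using long_ray_zero_le by (auto simp: unbounded_on_face_def)
next
  assume "\<exists>z. \<forall>p\<in>topspace (long_ray_power n). f p \<le> z"
  then show "homotopic_with (\<lambda>_. True) (long_ray_power n) euclidean f (\<lambda>_. 0)"
    using bounded_homotopy_to_zero[OF f] homotopic_withI_topspace by metis
qed

text \<open>Treats both halves at once. Continuity of \<open>part\<close> on the whole line makes
  each half a retract, so a homotopy in the line between maps into one half can be pushed into that
  half.\<close>

locale half_line =
  fixes ray :: "long_ray \<Rightarrow> long_line" and part :: "long_line \<Rightarrow> long_ray"
  assumes continuous_ray: "continuous_on UNIV ray"
    and continuous_part: "continuous_on UNIV part"
    and part_ray: "part (ray x) = x"
begin

abbreviation half :: "long_line topology" where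
  "half \<equiv> subtopology euclidean (range ray)"

definition bounded_maps :: "nat \<Rightarrow> ((nat \<Rightarrow> long_ray) \<Rightarrow> long_line) set" where
  "bounded_maps n = {f. continuous_map (long_ray_power n) half f \<and>
     (\<exists>z. f ` topspace (long_ray_power n) \<subseteq> ray ` {0..z})}"

lemma continuous_map_part:
  "continuous_map X euclidean f \<Longrightarrow> continuous_map X euclidean (\<lambda>p. part (f p))"
  using continuous_map_compose[of X euclidean f euclidean part] continuous_part by (simp add: o_def)

lemma continuous_map_ray: "continuous_map euclidean half ray"
  using continuous_ray by (simp add: continuous_map_in_subtopology)

lemma ray_part:
  assumes "continuous_map X half f" "p \<in> topspace X"
  shows "ray (part (f p)) = f p"
proof -
  have "f p \<in> range ray" using assms by (auto simp: continuous_map_in_subtopology)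
  then show ?thesis by (auto simp: part_ray)
qed

lemma homotopic_part:
  assumes "homotopic_with (\<lambda>_. True) X euclidean f g"
  shows "homotopic_with (\<lambda>_. True) X euclidean (\<lambda>p. part (f p)) (\<lambda>p. part (g p))"
  using homotopic_with_compose_continuous_map_left[OF assms, where h = part and q = "\<lambda>_. True"] continuous_part
  by (simp add: o_def)

lemma homotopic_half_if_part:
  assumes "homotopic_with (\<lambda>_. True) X euclidean (\<lambda>p. part (f p)) (\<lambda>p. part (g p))"
    and "continuous_map X half f" "continuous_map X half g"
  shows "homotopic_with (\<lambda>_. True) X half f g"
proof -
  have "homotopic_with (\<lambda>_. True) X half (ray \<circ> (\<lambda>p. part (f p))) (ray \<circ> (\<lambda>p. part (g p)))"
    by (rule homotopic_with_compose_continuous_map_left[OF assms(1) continuous_map_ray]) simp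
  then show ?thesis
    by (rule homotopic_with_eq) (use ray_part[OF assms(2)] ray_part[OF assms(3)] in auto)
qed

lemma homotopic_half_if_homotopic:
  assumes "homotopic_with (\<lambda>_. True) X euclidean f g"
    and "continuous_map X half f" "continuous_map X half g"
  shows "homotopic_with (\<lambda>_. True) X half f g"
  using homotopic_half_if_part[OF homotopic_part[OF assms(1)] assms(2,3)] .

text \<open>Through \<open>ray\<close> and \<open>part\<close> this reduces to the long ray, where
  boundedness is the same as being homotopic to \<open>0\<close>. It proves that the bounded maps
  form a single class.\<close>

lemma bounded_maps_eq_class:
  "bounded_maps n = homotopy_rel (long_ray_power n) half `` {\<lambda>_. ray 0}"
proof -
  let ?X = "long_ray_power n"
  have const: "continuous_map ?X half (\<lambda>_. ray 0)" by (simp add: continuous_map_in_subtopology)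
  have "f \<in> bounded_maps n \<longleftrightarrow> homotopic_with (\<lambda>_. True) ?X half (\<lambda>_. ray 0) f"
    if f: "continuous_map ?X half f" for f
  proof -
    have f': "continuous_map ?X euclidean f" using f continuous_map_in_subtopology by blast
    have "f \<in> bounded_maps n \<longleftrightarrow> (\<exists>z. \<forall>p\<in>topspace ?X. part (f p) \<le> z)"
    proof
      assume "f \<in> bounded_maps n"
      then obtain z where "f ` topspace ?X \<subseteq> ray ` {0..z}" by (auto simp: bounded_maps_def)
      then have "part (f p) \<le> z" if "p \<in> topspace ?X" for p
        using that by (force simp: part_ray)
      then show "\<exists>z. \<forall>p\<in>topspace ?X. part (f p) \<le> z" by blast
    next
      assume "\<exists>z. \<forall>p\<in>topspace ?X. part (f p) \<le> z"
      then obtain z where z: "\<And>p. p \<in> topspace ?X \<Longrightarrow> part (f p) \<le> z" by blast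
      have "f p \<in> ray ` {0..z}" if "p \<in> topspace ?X" for p
        using z[OF that] ray_part[OF f that] long_ray_zero_le[of "part (f p)"]
        by (intro image_eqI[of _ _ "part (f p)"]) auto
      then show "f \<in> bounded_maps n" using f by (auto simp: bounded_maps_def)
    qed
    also have "\<dots> \<longleftrightarrow> homotopic_with (\<lambda>_. True) ?X euclidean (\<lambda>p. part (f p)) (\<lambda>_. 0)"
      using homotopic_zero_iff_bounded[OF continuous_map_part[OF f']] by simp
    also have "\<dots> \<longleftrightarrow> homotopic_with (\<lambda>_. True) ?X half f (\<lambda>_. ray 0)"
    proof
      show "homotopic_with (\<lambda>_. True) ?X half f (\<lambda>_. ray 0)"
        if "homotopic_with (\<lambda>_. True) ?X euclidean (\<lambda>p. part (f p)) (\<lambda>_. 0)"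
        by (rule homotopic_half_if_part) (use that f const in \<open>simp_all add: part_ray\<close>)
      show "homotopic_with (\<lambda>_. True) ?X euclidean (\<lambda>p. part (f p)) (\<lambda>_. 0)"
        if "homotopic_with (\<lambda>_. True) ?X half f (\<lambda>_. ray 0)"
        using homotopic_with_compose_continuous_map_left[OF that, where h = part and q = "\<lambda>_. True"]
          continuous_on_subset[OF continuous_part, of "range ray"]
        by (simp add: o_def part_ray)
    qed
    also have "\<dots> \<longleftrightarrow> homotopic_with (\<lambda>_. True) ?X half (\<lambda>_. ray 0) f"
      by (rule homotopic_with_sym)
    finally show ?thesis .
  qed
  moreover have "continuous_map ?X half f" if "f \<in> bounded_maps n" for f
    using that by (simp add: bounded_maps_def)
  moreover have "continuous_map ?X half f" if "homotopic_with (\<lambda>_. True) ?X half (\<lambda>_. ray 0) f" for f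
    using homotopic_with_imp_continuous_maps[OF that] by blast
  ultimately show ?thesis unfolding homotopy_rel_def by blast
qed

lemma bounded_maps_in_classes: "bounded_maps n \<in> homotopy_classes (long_ray_power n) half"
  unfolding bounded_maps_eq_class homotopy_classes_def
  by (intro quotientI) (simp add: continuous_map_in_subtopology)

lemma induced_map_half:
  assumes "continuous_map X half f"
  shows "induced_map (\<lambda>y. y) X euclidean (homotopy_rel X half `` {f}) = homotopy_rel X euclidean `` {f}"
proof -
  have "continuous_map half euclidean (\<lambda>y. y)" by (simp add: continuous_map_from_subtopology)
  from induced_map_class[OF this assms] show ?thesis by (simp add: o_def)
qed

text \<open>Applied when \<open>g\<close> takes values in the opposite half: \<open>part\<close>
  sends the homotopy to a contraction of \<open>part (f p)\<close> to \<open>0\<close>.\<close>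

lemma class_eq_bounded_maps:
  assumes f: "continuous_map (long_ray_power n) half f"
    and fg: "homotopic_with (\<lambda>_. True) (long_ray_power n) euclidean f g"
    and g: "\<And>p. p \<in> topspace (long_ray_power n) \<Longrightarrow> part (g p) = 0"
  shows "homotopy_rel (long_ray_power n) half `` {f} = bounded_maps n"
proof -
  have "homotopic_with (\<lambda>_. True) (long_ray_power n) euclidean (\<lambda>p. part (f p)) (\<lambda>p. part (ray 0))"
    by (rule homotopic_with_eq[OF homotopic_part[OF fg]]) (use g in \<open>auto simp: part_ray\<close>)
  then have "homotopic_with (\<lambda>_. True) (long_ray_power n) half f (\<lambda>p. ray 0)"
    by (rule homotopic_half_if_part) (use f in \<open>simp_all add: continuous_map_in_subtopology\<close>)
  then show ?thesis
    unfolding bounded_maps_eq_class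
    by (intro equiv_class_eq[OF equiv_homotopy_rel]) (simp add: homotopy_rel_def)
qed

end

interpretation pos: half_line pos_ray pos_part
  by standard (simp_all add: continuous_pos_ray continuous_pos_part)

interpretation neg: half_line neg_ray neg_part
  by standard (simp_all add: continuous_neg_ray continuous_neg_part)

lemma bounded_pos_eq: "bounded_pos n = pos.bounded_maps n"
  by (simp add: bounded_pos_def pos.bounded_maps_def L_pos_def)

lemma bounded_neg_eq: "bounded_neg n = neg.bounded_maps n"
  by (simp add: bounded_neg_def neg.bounded_maps_def L_neg_def)

lemma pos_or_neg_part_bounded:
  assumes f: "continuous_map (long_ray_power n) euclidean f"
  shows "(\<exists>z. \<forall>p\<in>topspace (long_ray_power n). pos_part (f p) \<le> z) \<or>
    (\<exists>z. \<forall>p\<in>topspace (long_ray_power n). neg_part (f p) \<le> z)"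
proof (rule ccontr)
  assume "\<not> ?thesis"
  then have unb: "unbounded_on_face {1..n} (\<lambda>p. pos_part (f p)) {1..n}"
    "unbounded_on_face {1..n} (\<lambda>p. neg_part (f p)) {1..n}"
    using bounded_iff_not_unbounded_on_face[OF pos.continuous_map_part[OF f]]
      bounded_iff_not_unbounded_on_face[OF neg.continuous_map_part[OF f]] by blast+
  have sc: "seq_cont {1..n} (\<lambda>p. pos_part (f p))" "seq_cont {1..n} (\<lambda>p. neg_part (f p))"
    using pos.continuous_map_part[OF f] neg.continuous_map_part[OF f]
    by (auto intro!: continuous_map_imp_seq_cont simp: power_top_def)
  have "\<forall>\<^sub>F c in club. False"
    using face_bounded_iff(2)[OF sc(1) finite_atLeastAtMost unb(1), of 0]
      face_bounded_iff(2)[OF sc(2) finite_atLeastAtMost unb(2), of 0] eventually_club_gt[of undefined]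
  proof eventually_elim
    case (elim c)
    let ?y = "f (face_point {1..n} {1..n} c (\<lambda>_. 0))"
    have "pos_part ?y = pt c" "neg_part ?y = pt c" using elim(1,2) by simp_all
    then have "pt c = 0" using pos_part_0_or_neg_part_0[of ?y] by simp
    \<comment> \<open>Any ordinal below \<open>c\<close> makes \<open>pt c\<close> positive;
      \<open>undefined\<close> is an arbitrary choice.\<close>
    moreover have "0 < pt c" using elim(3) long_ray_zero_le[of "pt undefined"] by (metis le_less_trans pt_less_pt)
    ultimately show False by simp
  qed
  then show False by simp
qed

lemma homotopic_into_half_line:
  assumes f: "continuous_map (long_ray_power n) euclidean f"
  shows "homotopic_with (\<lambda>_. True) (long_ray_power n) euclidean f (\<lambda>p. pos_ray (pos_part (f p))) \<or>
    homotopic_with (\<lambda>_. True) (long_ray_power n) euclidean f (\<lambda>p. neg_ray (neg_part (f p)))"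
proof -
  let ?X = "long_ray_power n" and ?Z = "prod_topology (top_of_set {0..1::real}) (long_ray_power n)"
  note cp = pos.continuous_map_part[OF f] and cn = neg.continuous_map_part[OF f]
  have lift: "continuous_map ?Z euclidean (\<lambda>z. u (snd z))" if "continuous_map ?X euclidean u"
    for u :: "_ \<Rightarrow> long_ray"
    using continuous_map_compose[OF continuous_map_snd that] by (simp add: o_def)
  show ?thesis
    using pos_or_neg_part_bounded[OF f]
  proof (elim disjE exE)
    fix z assume z: "\<forall>p\<in>topspace ?X. pos_part (f p) \<le> z"
    obtain h where h: "continuous_map ?Z euclidean h"
      "\<And>p. p \<in> topspace ?X \<Longrightarrow> h (0, p) = pos_part (f p)" "\<And>p. p \<in> topspace ?X \<Longrightarrow> h (1, p) = 0"
      "\<And>t p. t \<in> {0..1} \<Longrightarrow> p \<in> topspace ?X \<Longrightarrow> pos_part (f p) = 0 \<Longrightarrow> h (t, p) = 0"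
      by (rule bounded_homotopy_to_zero[OF cp z]) (rule that)
    \<comment> \<open>Where the positive part vanishes the contraction does not move, so the pair
      stays on the axes throughout the homotopy and \<open>wedge\<close> remains continuous.\<close>
    have "h z = 0 \<or> neg_part (f (snd z)) = 0" if "z \<in> topspace ?Z" for z
      using h(4)[of "fst z" "snd z"] pos_part_0_or_neg_part_0[of "f (snd z)"] that by auto
    then have "continuous_map ?Z euclidean (\<lambda>z. wedge (h z) (neg_part (f (snd z))))"
      by (rule continuous_map_wedge[OF h(1) lift[OF cn]])
    then have "homotopic_with (\<lambda>_. True) ?X euclidean f (\<lambda>p. neg_ray (neg_part (f p)))"
      by (rule homotopic_withI_topspace) (use h(2,3) wedge_parts in auto)
    then show ?thesis ..
  next
    fix z assume z: "\<forall>p\<in>topspace ?X. neg_part (f p) \<le> z"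
    obtain h where h: "continuous_map ?Z euclidean h"
      "\<And>p. p \<in> topspace ?X \<Longrightarrow> h (0, p) = neg_part (f p)" "\<And>p. p \<in> topspace ?X \<Longrightarrow> h (1, p) = 0"
      "\<And>t p. t \<in> {0..1} \<Longrightarrow> p \<in> topspace ?X \<Longrightarrow> neg_part (f p) = 0 \<Longrightarrow> h (t, p) = 0"
      by (rule bounded_homotopy_to_zero[OF cn z]) (rule that)
    have "pos_part (f (snd z)) = 0 \<or> h z = 0" if "z \<in> topspace ?Z" for z
      using h(4)[of "fst z" "snd z"] pos_part_0_or_neg_part_0[of "f (snd z)"] that by auto
    then have "continuous_map ?Z euclidean (\<lambda>z. wedge (pos_part (f (snd z))) (h z))"
      by (rule continuous_map_wedge[OF lift[OF cp] h(1)])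
    then have "homotopic_with (\<lambda>_. True) ?X euclidean f (\<lambda>p. pos_ray (pos_part (f p)))"
      by (rule homotopic_withI_topspace) (use h(2,3) wedge_parts in auto)
    then show ?thesis ..
  qed
qed

section \<open>The bijection from the glued half classes\<close>

lemma bij_betw_the_elem_quotient:
  assumes r: "equiv A r" and F: "F respects r" and "F ` A = B"
    and inj: "\<And>x y. x \<in> A \<Longrightarrow> y \<in> A \<Longrightarrow> F x = F y \<Longrightarrow> (x, y) \<in> r"
  shows "bij_betw (\<lambda>C. the_elem (F ` C)) (A // r) B"
proof -
  have img: "F ` (r `` {x}) = {F x}" if "x \<in> A" for x
    using equiv_class_self[OF r that] F by (auto simp: congruent_def)
  show ?thesis
  proof (rule bij_betw_imageI)
    show "inj_on (\<lambda>C. the_elem (F ` C)) (A // r)"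
    proof (rule inj_onI)
      fix C D assume "C \<in> A // r" "D \<in> A // r" and eq: "the_elem (F ` C) = the_elem (F ` D)"
      then obtain x y where "x \<in> A" "C = r `` {x}" "y \<in> A" "D = r `` {y}" by (auto elim!: quotientE)
      moreover from this have "(x, y) \<in> r" using eq by (intro inj) (simp_all add: img)
      ultimately show "C = D" using equiv_class_eq[OF r] by blast
    qed
    have "(\<lambda>C. the_elem (F ` C)) ` (A // r) = F ` A"
      unfolding quotient_def using img by (auto simp: image_UN image_image)
    then show "(\<lambda>C. the_elem (F ` C)) ` (A // r) = B" using assms(3) by simp
  qed
qed

text \<open>Surjectivity is the contraction into one half. For injectivity, two classes from the
  same half are separated by the retraction, and classes from opposite halves can only meet in the
  bounded class.\<close>

lemma homotopy_classes_long_ray_power_long_line: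
  "bounded_pos n \<in> homotopy_classes (long_ray_power n) L_pos \<and>
   bounded_neg n \<in> homotopy_classes (long_ray_power n) L_neg \<and>
   inclusion_map n respects bounded_glue n \<and>
   bij_betw (\<lambda>C. the_elem (inclusion_map n ` C))
     (half_classes n // bounded_glue n)
     (homotopy_classes (long_ray_power n) (euclidean :: long_line topology))"
proof -
  let ?X = "long_ray_power n" and ?Y = "euclidean :: long_line topology"
  have bp: "bounded_pos n \<in> homotopy_classes ?X L_pos"
    unfolding bounded_pos_eq L_pos_def by (rule pos.bounded_maps_in_classes)
  have bn: "bounded_neg n \<in> homotopy_classes ?X L_neg"
    unfolding bounded_neg_eq L_neg_def by (rule neg.bounded_maps_in_classes)
  have incl_pos: "inclusion_map n (Inl (homotopy_rel ?X L_pos `` {f})) = homotopy_rel ?X ?Y `` {f}"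
    if "continuous_map ?X L_pos f" for f
    using pos.induced_map_half[of ?X f] that by (simp add: inclusion_map_def L_pos_def)
  have incl_neg: "inclusion_map n (Inr (homotopy_rel ?X L_neg `` {f})) = homotopy_rel ?X ?Y `` {f}"
    if "continuous_map ?X L_neg f" for f
    using neg.induced_map_half[of ?X f] that by (simp add: inclusion_map_def L_neg_def)
  have in_L: "continuous_map ?X L_pos (\<lambda>p. pos_ray (u p))" "continuous_map ?X L_neg (\<lambda>p. neg_ray (u p))"
    if "continuous_map ?X euclidean u" for u
    using continuous_map_compose[OF that pos.continuous_map_ray]
      continuous_map_compose[OF that neg.continuous_map_ray] by (simp_all add: o_def L_pos_def L_neg_def)
  have glue: "inclusion_map n (Inl (bounded_pos n)) = inclusion_map n (Inr (bounded_neg n))"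
    using incl_pos[OF in_L(1)[of "\<lambda>_. 0"]] incl_neg[OF in_L(2)[of "\<lambda>_. 0"]]
    unfolding bounded_pos_eq bounded_neg_eq pos.bounded_maps_eq_class neg.bounded_maps_eq_class
    by (simp add: L_pos_def L_neg_def neg_ray_0)
  have resp: "inclusion_map n respects bounded_glue n"
    using glue by (auto simp: congruent_def bounded_glue_def)
  have half_bounded: "Inl (bounded_pos n) \<in> half_classes n" "Inr (bounded_neg n) \<in> half_classes n"
    using bp bn by (auto simp: half_classes_def)
  have eqv: "equiv (half_classes n) (bounded_glue n)"
  proof (rule equivI)
    show "bounded_glue n \<subseteq> half_classes n \<times> half_classes n"
      using half_bounded by (auto simp: bounded_glue_def)
    show "refl_on (half_classes n) (bounded_glue n)"
      by (auto simp: bounded_glue_def refl_on_def)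
    show "sym (bounded_glue n)" "trans (bounded_glue n)"
      using half_bounded by (auto simp: bounded_glue_def sym_def trans_def)
  qed
  have half: "\<exists>f. continuous_map ?X L_pos f \<and> c = Inl (homotopy_rel ?X L_pos `` {f}) \<or>
      continuous_map ?X L_neg f \<and> c = Inr (homotopy_rel ?X L_neg `` {f})" if "c \<in> half_classes n" for c
    using that by (auto simp: half_classes_def homotopy_classes_def quotient_def)
  have homD: "homotopic_with (\<lambda>_. True) ?X ?Y f g"
    if "homotopy_rel ?X ?Y `` {f} = homotopy_rel ?X ?Y `` {g}"
      "continuous_map ?X ?Y f" "continuous_map ?X ?Y g" for f g
    using that by (subst (asm) eq_equiv_class_iff[OF equiv_homotopy_rel]) (simp_all add: homotopy_rel_def)
  have L_cont: "continuous_map ?X ?Y f" if "continuous_map ?X L_pos f \<or> continuous_map ?X L_neg f" for f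
    using that by (auto simp: L_pos_def L_neg_def continuous_map_in_subtopology)
  \<comment> \<open>Each of the two maps has vanishing part on the side of the other, so the
    homotopy makes both null-homotopic in their own halves; this identifies exactly the glued
    pair.\<close>
  have mixed: "homotopy_rel ?X L_pos `` {f} = bounded_pos n \<and> homotopy_rel ?X L_neg `` {g} = bounded_neg n"
    if f: "continuous_map ?X L_pos f" and g: "continuous_map ?X L_neg g"
      and fg: "homotopic_with (\<lambda>_. True) ?X ?Y f g" for f g
  proof
    have "g p \<in> range neg_ray" "f p \<in> range pos_ray" if "p \<in> topspace ?X" for p
      using f g that by (auto simp: L_pos_def L_neg_def continuous_map_in_subtopology)
    then have "pos_part (g p) = 0" "neg_part (f p) = 0" if "p \<in> topspace ?X" for p
      using that by (metis imageE parts_ray)+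
    then show "homotopy_rel ?X L_pos `` {f} = bounded_pos n" "homotopy_rel ?X L_neg `` {g} = bounded_neg n"
      using pos.class_eq_bounded_maps[of n f g] neg.class_eq_bounded_maps[of n g f] f g fg
        homotopic_with_symD[OF fg]
      by (simp_all add: bounded_pos_eq bounded_neg_eq L_pos_def L_neg_def)
  qed
  have inj: "(c, d) \<in> bounded_glue n"
    if c: "c \<in> half_classes n" and d: "d \<in> half_classes n" and cd: "inclusion_map n c = inclusion_map n d" for c d
  proof -
    obtain f where f: "continuous_map ?X L_pos f \<and> c = Inl (homotopy_rel ?X L_pos `` {f}) \<or>
      continuous_map ?X L_neg f \<and> c = Inr (homotopy_rel ?X L_neg `` {f})" using half[OF c] by blast
    obtain g where g: "continuous_map ?X L_pos g \<and> d = Inl (homotopy_rel ?X L_pos `` {g}) \<or>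
      continuous_map ?X L_neg g \<and> d = Inr (homotopy_rel ?X L_neg `` {g})" using half[OF d] by blast
    have "inclusion_map n c = homotopy_rel ?X ?Y `` {f}" "inclusion_map n d = homotopy_rel ?X ?Y `` {g}"
      using f g incl_pos incl_neg by auto
    then have fg: "homotopic_with (\<lambda>_. True) ?X ?Y f g"
      using cd f g by (intro homD L_cont) auto
    from f g show ?thesis
    proof (elim disjE conjE)
      assume fg': "continuous_map ?X L_pos f" "continuous_map ?X L_pos g"
        and *: "c = Inl (homotopy_rel ?X L_pos `` {f})" "d = Inl (homotopy_rel ?X L_pos `` {g})"
      have "homotopic_with (\<lambda>_. True) ?X L_pos f g"
        using pos.homotopic_half_if_homotopic[OF fg] fg' by (simp add: L_pos_def)
      then have "c = d"
        unfolding * using equiv_class_eq[OF equiv_homotopy_rel, of f g ?X L_pos] by (simp add: homotopy_rel_def)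
      then show ?thesis using c by (auto simp: bounded_glue_def)
    next
      assume fg': "continuous_map ?X L_neg f" "continuous_map ?X L_neg g"
        and *: "c = Inr (homotopy_rel ?X L_neg `` {f})" "d = Inr (homotopy_rel ?X L_neg `` {g})"
      have "homotopic_with (\<lambda>_. True) ?X L_neg f g"
        using neg.homotopic_half_if_homotopic[OF fg] fg' by (simp add: L_neg_def)
      then have "c = d"
        unfolding * using equiv_class_eq[OF equiv_homotopy_rel, of f g ?X L_neg] by (simp add: homotopy_rel_def)
      then show ?thesis using c by (auto simp: bounded_glue_def)
    next
      assume "continuous_map ?X L_pos f" "continuous_map ?X L_neg g"
        "c = Inl (homotopy_rel ?X L_pos `` {f})" "d = Inr (homotopy_rel ?X L_neg `` {g})"
      then show ?thesis using mixed[OF _ _ fg] by (simp add: bounded_glue_def)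
    next
      assume "continuous_map ?X L_neg f" "continuous_map ?X L_pos g"
        "c = Inr (homotopy_rel ?X L_neg `` {f})" "d = Inl (homotopy_rel ?X L_pos `` {g})"
      then show ?thesis using mixed[OF _ _ homotopic_with_symD[OF fg]] by (simp add: bounded_glue_def)
    qed
  qed
  have surj: "inclusion_map n ` half_classes n = homotopy_classes ?X ?Y"
  proof
    show "inclusion_map n ` half_classes n \<subseteq> homotopy_classes ?X ?Y"
    proof (rule image_subsetI)
      fix c assume "c \<in> half_classes n"
      then obtain f where f: "continuous_map ?X L_pos f \<and> c = Inl (homotopy_rel ?X L_pos `` {f}) \<or>
        continuous_map ?X L_neg f \<and> c = Inr (homotopy_rel ?X L_neg `` {f})" using half by blast
      then have "inclusion_map n c = homotopy_rel ?X ?Y `` {f}" using incl_pos incl_neg by auto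
      then show "inclusion_map n c \<in> homotopy_classes ?X ?Y"
        unfolding homotopy_classes_def using f by (auto intro!: quotientI L_cont)
    qed
    show "homotopy_classes ?X ?Y \<subseteq> inclusion_map n ` half_classes n"
    proof
      fix c assume "c \<in> homotopy_classes ?X ?Y"
      then obtain f where f: "continuous_map ?X ?Y f" and c: "c = homotopy_rel ?X ?Y `` {f}"
        by (auto simp: homotopy_classes_def elim: quotientE)
      let ?p = "\<lambda>p. pos_ray (pos_part (f p))" and ?q = "\<lambda>p. neg_ray (neg_part (f p))"
      have c_eq: "c = homotopy_rel ?X ?Y `` {g}" if "homotopic_with (\<lambda>_. True) ?X ?Y f g" for g
        unfolding c using that by (intro equiv_class_eq[OF equiv_homotopy_rel]) (simp add: homotopy_rel_def)
      have p: "continuous_map ?X L_pos ?p" and q: "continuous_map ?X L_neg ?q"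
        using in_L pos.continuous_map_part[OF f] neg.continuous_map_part[OF f] by auto
      then have half_pq: "Inl (homotopy_rel ?X L_pos `` {?p}) \<in> half_classes n"
        "Inr (homotopy_rel ?X L_neg `` {?q}) \<in> half_classes n"
        by (auto simp: half_classes_def homotopy_classes_def intro: quotientI)
      show "c \<in> inclusion_map n ` half_classes n"
        using homotopic_into_half_line[OF f]
      proof
        assume "homotopic_with (\<lambda>_. True) ?X ?Y f ?p"
        then have "c = inclusion_map n (Inl (homotopy_rel ?X L_pos `` {?p}))"
          using c_eq incl_pos[OF p] by simp
        then show ?thesis using half_pq(1) by (rule image_eqI)
      next
        assume "homotopic_with (\<lambda>_. True) ?X ?Y f ?q"
        then have "c = inclusion_map n (Inr (homotopy_rel ?X L_neg `` {?q}))"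
          using c_eq incl_neg[OF q] by simp
        then show ?thesis using half_pq(2) by (rule image_eqI)
      qed
    qed
  qed
  show ?thesis
    using bp bn resp bij_betw_the_elem_quotient[OF eqv resp surj inj] by blast
qed

theorem theorem3:
  fixes n :: nat
  assumes "n \<ge> 1"
  shows
    "(\<exists>\<phi>. bij_betw \<phi>
        (homotopy_classes (long_line_power n) (euclidean :: long_ray topology))
        {A. A \<subseteq> admissible_sets n - {{}} \<and> antichain A}) \<and>
     (bounded_pos n \<in> homotopy_classes (long_ray_power n) L_pos \<and>
      bounded_neg n \<in> homotopy_classes (long_ray_power n) L_neg \<and>
      inclusion_map n respects bounded_glue n \<and>
      bij_betw (\<lambda>C. the_elem (inclusion_map n ` C))
        (half_classes n // bounded_glue n)
        (homotopy_classes (long_ray_power n) (euclidean :: long_line topology)))"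
  using homotopy_classes_long_line_power_long_ray[of n] homotopy_classes_long_ray_power_long_line[of n]
  by (rule conjI)

end
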